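(* If $c>c^*$, then there exists a positive function $\phi\in C^2(\mathbb{R},\mathbb{R})$ (i.e. $\phi(\xi)>0$ for all $\xi\in\mathbb{R}$) satisfying $$\phi''(\xi)-c\,\phi'(\xi)-d\,\phi(\xi)+b\big(\phi(\xi-c\,\tau(\phi(\xi)))\big)=0,\qquad \xi\in\mathbb{R},$$ together with $$\lim_{\xi\to-\infty}\phi(\xi)=0,\qquad \liminf_{\xi\to+\infty}\phi(\xi)>0.$$
   Context: Setting. $d>0$ is a constant. The birth function $b:[0,\infty)\to[0,\infty)$ satisfies, for some constant $K>0$: $b(0)=0$, $b(K)=dK$, $b(u)>du$ for $u\in(0,K)$, and $0<b(u)<du$ for $u>K$. The delay function $\tau:[0,\infty)\to[0,\infty)$ is $C^1$ on $[0,\infty)$, satisfies $0\le\tau'(u)<1$ for all $u\ge 0$, and $0\le m:=\tau(0)\le\lim_{u\to\infty}\tau(u)=:M<\infty$. Further assumptions ($b$ need not be monotone): $b$ is $C^1$ on $[0,\infty)$; $b'(0)>d$ and $b(u)<b'(0)u$ for $u\in(0,\infty)$; $|b'(u)|\le b'(0)$ for $u\in[0,K]$; and there is $L>0$ such that $0\le b'(0)u-b(u)<Lu^2$ for $u\in(0,K]$. Definition of $c^*$. For $\lambda\ge0$, $c\ge0$ let $\Lambda(\lambda,c)=\lambda^2-c\lambda-d+b'(0)e^{-\lambda c m}$. Then $c^*>0$ is the constant such that $\Lambda(\lambda,c)>0$ for all $\lambda\ge0$ if $c\in[0,c^* )$, while for $c>c^*$ the equation $\Lambda(\lambda,c)=0$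 has exactly two distinct positive real roots $\lambda_1(c)<\lambda_2(c)$, with $\Lambda(\cdot,c)<0$ on $(\lambda_1(c),\lambda_2(c))$ and $\Lambda(\cdot,c)>0$ on $[0,\lambda_1(c))\cup(\lambda_2(c),\infty)$. *)

theory Defs
  imports "HOL-Analysis.Analysis"
begin

text \<open>
  Functions on $[0,\infty)$ are represented by total functions on the reals that are only
  constrained on \<^term>\<open>{0::real..}\<close>; at \<open>0\<close> the derivative is the one-sided one.
\<close>

definition C1_halfline :: "(real \<Rightarrow> real) \<Rightarrow> (real \<Rightarrow> real) \<Rightarrow> bool" where
  "C1_halfline f f' \<longleftrightarrow>
     (\<forall>u\<ge>0. (f has_real_derivative f' u) (at u within {0..})) \<and> continuous_on {0..} f'"

definition C2_real :: "(real \<Rightarrow> real) \<Rightarrow> (real \<Rightarrow> real) \<Rightarrow> (real \<Rightarrow> real) \<Rightarrow> bool" where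
  "C2_real f f' f'' \<longleftrightarrow>
     (\<forall>x. (f has_real_derivative f' x) (at x)) \<and>
     (\<forall>x. (f' has_real_derivative f'' x) (at x)) \<and> continuous_on UNIV f''"

text \<open>In the following, \<open>\<beta>\<close> stands for $b'(0)$ and \<open>m\<close> for $\tau(0)$.\<close>

definition char_fun :: "real \<Rightarrow> real \<Rightarrow> real \<Rightarrow> real \<Rightarrow> real \<Rightarrow> real" where
  "char_fun d \<beta> m l c = l\<^sup>2 - c * l - d + \<beta> * exp (- l * c * m)"

definition is_critical_speed :: "real \<Rightarrow> real \<Rightarrow> real \<Rightarrow> real \<Rightarrow> bool" where
  "is_critical_speed d \<beta> m cs \<longleftrightarrow>
     cs > 0 \<and>
     (\<forall>c\<in>{0..<cs}. \<forall>l\<ge>0. char_fun d \<beta> m l c > 0) \<and>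
     (\<forall>c>cs. \<exists>l1 l2. l1 < l2 \<and>
        {l. 0 < l \<and> char_fun d \<beta> m l c = 0} = {l1, l2} \<and>
        (\<forall>l\<in>{l1<..<l2}. char_fun d \<beta> m l c < 0) \<and>
        (\<forall>l\<in>{0..<l1} \<union> {l2<..}. char_fun d \<beta> m l c > 0))"

definition critical_speed :: "real \<Rightarrow> real \<Rightarrow> real \<Rightarrow> real" where
  "critical_speed d \<beta> m = (THE cs. is_critical_speed d \<beta> m cs)"

lemma is_critical_speed_unique:
  assumes "is_critical_speed d \<beta> m x" "is_critical_speed d \<beta> m y"
  shows "x = y"
proof -
  have False if x: "is_critical_speed d \<beta> m x" and y: "is_critical_speed d \<beta> m y"
    and less: "x < y" for x y
  proof -
    define c where "c = (x + y) / 2"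
    have c: "x < c" "c < y" using less by (auto simp: c_def)
    obtain l1 l2 where "{l. 0 < l \<and> char_fun d \<beta> m l c = 0} = {l1, l2}"
      using x c(1) unfolding is_critical_speed_def by blast
    then have l1: "0 < l1" "char_fun d \<beta> m l1 c = 0" by auto
    have "c \<in> {0..<y}" using x c unfolding is_critical_speed_def by auto
    moreover have "\<forall>c\<in>{0..<y}. \<forall>l\<ge>0. char_fun d \<beta> m l c > 0"
      using y unfolding is_critical_speed_def by blast
    ultimately have "char_fun d \<beta> m l1 c > 0" using l1(1) by simp
    with l1(2) show False by simp
  qed
  with assms show ?thesis by (meson linorder_neqE_linordered_idom)
qed

lemma convex_on_char_fun:
  assumes "\<beta> \<ge> 0"
  shows "convex_on UNIV (\<lambda>l. char_fun d \<beta> m l c)"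
proof (rule f''_ge0_imp_convex)
  show "((\<lambda>l. char_fun d \<beta> m l c) has_real_derivative
          2 * l - c - \<beta> * (c * m) * exp (- l * c * m)) (at l)" for l
    unfolding char_fun_def by (auto intro!: derivative_eq_intros simp: algebra_simps)
  show "((\<lambda>l. 2 * l - c - \<beta> * (c * m) * exp (- l * c * m)) has_real_derivative
          2 + \<beta> * (c * m)\<^sup>2 * exp (- l * c * m)) (at l)" for l
    by (auto intro!: derivative_eq_intros simp: algebra_simps power2_eq_square)
  show "2 + \<beta> * (c * m)\<^sup>2 * exp (- l * c * m) \<ge> 0" for l
    using assms by simp
qed auto

lemma convex_on_neg_between:
  fixes g :: "real \<Rightarrow> real"
  assumes g: "convex_on UNIV g" and "g x \<le> 0" "g y < 0"
    and z: "x < z \<and> z \<le> y \<or> y \<le> z \<and> z < x"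
  shows "g z < 0"
proof -
  define t where "t = (z - x) / (y - x)"
  have t: "0 < t" "t \<le> 1" using z by (auto simp: t_def field_simps)
  have "t * (y - x) = z - x" using z by (auto simp: t_def)
  then have "z = (1 - t) * x + t * y" by (simp add: algebra_simps)
  then have "g z \<le> (1 - t) * g x + t * g y"
    using convex_onD[OF g, of t x y] t by simp
  also have "\<dots> < 0"
    using assms(2,3) t by (intro add_nonpos_neg mult_nonneg_nonpos mult_pos_neg) auto
  finally show ?thesis .
qed

lemma is_critical_speed_exists:
  assumes d: "0 < d" and \<beta>: "d < \<beta>" and m: "0 \<le> m"
  shows "\<exists>cs. is_critical_speed d \<beta> m cs"
proof -
  define A where "A = {c. 0 \<le> c \<and> (\<forall>l\<ge>0. char_fun d \<beta> m l c > 0)}"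
  have \<beta>0: "\<beta> > 0" using d \<beta> by simp
  have mono: "char_fun d \<beta> m l c' < char_fun d \<beta> m l c" if "0 < l" "c < c'" for l c c'
  proof -
    have "exp (- l * c' * m) \<le> exp (- l * c * m)"
      using that m by (auto intro!: mult_mono mult_right_mono)
    then have "\<beta> * exp (- l * c' * m) \<le> \<beta> * exp (- l * c * m)"
      using \<beta>0 by (intro mult_left_mono) auto
    moreover have "c * l < c' * l" using that by simp
    ultimately show ?thesis unfolding char_fun_def by linarith
  qed
  have at0: "char_fun d \<beta> m 0 c > 0" for c using \<beta> by (simp add: char_fun_def)
  have lower: "l\<^sup>2 - c * l - d < char_fun d \<beta> m l c" for l c
    using \<beta>0 by (simp add: char_fun_def)

  have bdd: "bdd_above A"
  proof (rule bdd_aboveI)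
    fix c assume c: "c \<in> A"
    then have "char_fun d \<beta> m 1 c > 0" "c \<ge> 0" by (auto simp: A_def)
    moreover have "\<beta> * exp (- c * m) \<le> \<beta> * 1"
      using \<beta>0 m \<open>c \<ge> 0\<close> by (intro mult_left_mono) auto
    ultimately show "c \<le> 1 + \<beta>" using d by (simp add: char_fun_def)
  qed

  define R where "R = 1 + d"
  define e where "e = min (1/2) ((\<beta> - d) / (2 * (R * (1 + \<beta> * m))))"
  have Rp: "R * (1 + \<beta> * m) > 0"
    using d \<beta>0 m unfolding R_def by (intro mult_pos_pos add_pos_nonneg) auto
  have e0: "0 < e" using Rp \<beta> by (simp add: e_def)
  have e1: "e \<le> 1/2" unfolding e_def by (rule min.cobounded1)
  have "e \<le> (\<beta> - d) / (2 * (R * (1 + \<beta> * m)))"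
    unfolding e_def by (rule min.cobounded2)
  then have e2: "e * (R * (1 + \<beta> * m)) \<le> (\<beta> - d) / 2" using Rp by (simp add: field_simps)
  have "char_fun d \<beta> m l e > 0" if l: "l \<ge> 0" for l
  proof (cases "l \<le> R")
    case True
    have "\<beta> * (1 + (- l * e * m)) \<le> \<beta> * exp (- l * e * m)"
      using \<beta>0 exp_ge_add_one_self[of "- l * e * m"] by (intro mult_left_mono) auto
    moreover have "l * (e * (1 + \<beta> * m)) \<le> R * (e * (1 + \<beta> * m))"
      using True e0 \<beta>0 m by (intro mult_right_mono) auto
    ultimately have "d + e * l < \<beta> * exp (- l * e * m)"
      using e2 \<beta> by (simp add: algebra_simps)
    then show ?thesis using zero_le_power2[of l] unfolding char_fun_def by linarith
  next
    case False
    then have "R * (R - 1/2) \<le> l * (l - e)"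
      using e1 d by (intro mult_mono) (auto simp: R_def)
    moreover have "R * (R - 1/2) = d + (d * d + d / 2 + 1 / 2)"
      unfolding R_def by (simp add: field_simps)
    moreover have "d * d > 0" using d by simp
    ultimately have "l * (l - e) > d" using d by linarith
    then have "l\<^sup>2 - e * l - d > 0" by (simp add: power2_eq_square algebra_simps)
    then show ?thesis using lower[of l e] by linarith
  qed
  then have eA: "e \<in> A" using e0 by (simp add: A_def)

  define cs where "cs = Sup A"
  have pos: "cs > 0" using cSup_upper[OF eA bdd] e0 by (simp add: cs_def)
  have below: "char_fun d \<beta> m l c > 0" if lc: "c < cs" "l \<ge> 0" for l c
  proof -
    obtain c' where c': "c' \<in> A" "c < c'"
      using less_cSupE[of c A] eA lc(1) unfolding cs_def by blast
    show ?thesis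
    proof (cases "l = 0")
      case False
      then show ?thesis using mono[of l c c'] c' lc unfolding A_def by force
    qed (simp add: at0)
  qed

  have above: "\<exists>l1 l2. l1 < l2 \<and>
        {l. 0 < l \<and> char_fun d \<beta> m l c = 0} = {l1, l2} \<and>
        (\<forall>l\<in>{l1<..<l2}. char_fun d \<beta> m l c < 0) \<and>
        (\<forall>l\<in>{0..<l1} \<union> {l2<..}. char_fun d \<beta> m l c > 0)" if c: "c > cs" for c
  proof -
    define g where "g = (\<lambda>l. char_fun d \<beta> m l c)"
    define c0 where "c0 = (cs + c) / 2"
    have c0: "cs < c0" "c0 < c" using c by (auto simp: c0_def)
    have "c0 \<notin> A" using cSup_upper[OF _ bdd, of c0] c0 by (auto simp: cs_def)
    then obtain l0 where l0: "l0 \<ge> 0" "char_fun d \<beta> m l0 c0 \<le> 0"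
      using c0 pos by (auto simp: A_def not_less)
    have "l0 > 0" using l0 at0[of c0] by (cases "l0 = 0") auto
    have gl0: "g l0 < 0" using mono[OF \<open>l0 > 0\<close> c0(2)] l0 by (simp add: g_def)
    have cont: "continuous_on S g" for S
      unfolding g_def char_fun_def by (intro continuous_intros)
    have cvx: "convex_on UNIV g" unfolding g_def using \<beta>0 by (intro convex_on_char_fun) auto
    define B where "B = max l0 (c + d + 1)"
    have l0B: "l0 \<le> B" by (simp add: B_def)
    have "1 * (d + 1) \<le> B * (B - c)"
      using c pos d by (intro mult_mono) (auto simp: B_def)
    then have gB: "g B > 0" using lower[of B c]
      by (simp add: g_def power2_eq_square algebra_simps)
    have g0: "g 0 > 0" by (simp add: g_def at0)
    obtain l1 where l1: "0 \<le> l1" "l1 \<le> l0" "g l1 = 0"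
      using IVT2'[of g l0 0 0] gl0 g0 cont \<open>l0 > 0\<close> by auto
    obtain l2 where l2: "l0 \<le> l2" "l2 \<le> B" "g l2 = 0"
      using IVT'[of g l0 0 B] gl0 gB cont l0B by auto
    have ord: "0 < l1" "l1 < l0" "l0 < l2"
      using l1 l2 gl0 g0 by (auto simp: less_le)
    have neg: "g l < 0" if "l1 < l" "l < l2" for l
      using convex_on_neg_between[OF cvx, of l1 l0 l] convex_on_neg_between[OF cvx, of l2 l0 l]
        l1 l2 gl0 that by force
    have out1: "g l > 0" if "l < l1" for l
      using convex_on_neg_between[OF cvx, of l l0 l1] l1 gl0 that ord by force
    have out2: "g l > 0" if "l2 < l" for l
      using convex_on_neg_between[OF cvx, of l l0 l2] l2 gl0 that ord by force
    have "{l. 0 < l \<and> g l = 0} = {l1, l2}"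
    proof -
      have "l = l1 \<or> l = l2" if "g l = 0" for l
        using neg[of l] out1[of l] out2[of l] that by force
      then show ?thesis using ord l1 l2 by auto
    qed
    then show ?thesis using neg out1 out2 ord unfolding g_def
      by (intro exI[of _ l1] exI[of _ l2]) auto
  qed
  show ?thesis
    using pos below above unfolding is_critical_speed_def by (intro exI[of _ cs]) auto
qed

lemma is_critical_speed_critical_speed:
  assumes "0 < d" "d < \<beta>" "0 \<le> m"
  shows "is_critical_speed d \<beta> m (critical_speed d \<beta> m)"
proof -
  obtain cs where cs: "is_critical_speed d \<beta> m cs"
    using is_critical_speed_exists[OF assms] ..
  show ?thesis
    unfolding critical_speed_def
    by (rule theI[where P = "is_critical_speed d \<beta> m", OF cs])
      (rule is_critical_speed_unique[OF _ cs])
qed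

end

theory Submission
  imports Defs "HOL-Complex_Analysis.Great_Picard"
begin

text \<open>
  With \<open>\<lambda>\<close> the smaller root of the characteristic function, \<open>\<nu>\<close> slightly larger and \<open>q\<close> large,
  $\min(U, e^{\lambda x})$ and $\max(0, e^{\lambda x} - q e^{\nu x})$ are a super- and a subsolution;
  no monotonicity of \<open>b\<close> is needed, since its values are compared only through
  $\beta u - L u^2 \le b(u) \le \beta u$. A fixed point theorem is avoided: on $[-R, R]$ the arguments of \<open>b\<close>
  are clipped to these barriers and an extra delay $e > 0$ is added, so that the equation is solved
  step by step to the right of $-R$. Its solutions depend continuously on the slope at $-R$, the intermediate
  value theorem selects one with a prescribed value at \<open>R\<close>, and the maximum principle keeps it
  between the barriers, where the clipping is invisible. As $R \to \infty$ and $e \to 0$, Arzela-Ascoli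
  yields the wave. It stays away from \<open>0\<close> at $+\infty$ because a small minimum over the whole past
  contradicts $b(u) > d u$.
\<close>

section \<open>The linear problem and the maximum principle\<close>

text \<open>The delay is read off from the current value of the wave, and it can vanish if
  \<open>\<tau> 0 = 0\<close>, so the right-hand side at a point need not be determined by the past.
  Shifting both the argument of \<tau> and that of the wave by e removes this. The shift perturbs
  \<open>exp (lam * x)\<close> by a term of order \<open>e * exp (lam * x)\<close>, and the state
  dependence costs the same order with e replaced by \<open>exp (lam * x)\<close>, because \<tau> is
  Lipschitz and the solution lies below the upper barrier. With
  \<open>e \<le> exp (- lam * R)\<close> all errors on [-R, R] are of order
  \<open>exp (2 * lam * x)\<close>, just like \<open>L * u\<^sup>2\<close>; since
  \<open>nu < 2 * lam\<close>, the correction \<open>q * exp (nu * x)\<close> absorbs them for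
  \<open>x \<le> 0\<close>. Clipping does two things beyond keeping arguments in range. The forcing
  is at most \<open>d * U\<close> for every function, so shooting is a bounded perturbation of an
  affine map of the slope. And the barrier inequalities for the forcing hold for every function, so
  each comparison concerns a linear equation with known forcing. As b may exceed d K on [0, K], the
  upper level is not K but some U with \<open>b u \<le> d * U\<close> on [0, U].\<close>

lemma continuous_on_indefinite_integral:
  fixes f :: "real \<Rightarrow> real \<Rightarrow> real"
  assumes "continuous_on UNIV (\<lambda>z. f (fst z) (snd z))"
  shows "continuous_on UNIV (\<lambda>z. integral {a..max a (snd z)} (f (fst z)))"
proof -
  \<comment> \<open>The substitution \<open>x = a + t * (y - a)\<close> moves the variable endpoint
    into the integrand; what remains is an integral over a fixed interval with continuous
    parameters.\<close>
  have *: "integral {a..y} (f p) = (y - a) * integral {0..1} (\<lambda>t. f p (a + t * (y - a)))"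
    if "a \<le> y" for p y
  proof (cases "a = y")
    case False
    have "continuous_on {a..y} (\<lambda>x. f p x)"
      by (rule continuous_on_compose2[OF assms, of _ "\<lambda>x. (p, x)", simplified])
        (intro continuous_intros)
    then have "(f p has_integral integral {a..y} (f p)) {a..y}"
      by (intro integrable_integral integrable_continuous_real)
    then have "((\<lambda>t. f p ((y - a) *\<^sub>R t + a)) has_integral
        (1 / \<bar>y - a\<bar> ^ DIM(real)) *\<^sub>R integral {a..y} (f p))
        ((\<lambda>x. (1 / (y - a)) *\<^sub>R x + - ((1 / (y - a)) *\<^sub>R a)) ` cbox a y)"
      using False by (intro has_integral_affinity) auto
    moreover have "(\<lambda>x. (1 / (y - a)) *\<^sub>R x + - ((1 / (y - a)) *\<^sub>R a)) ` cbox a y = {0..1}"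
      using False that
      by (subst image_affinity_cbox) (auto simp: diff_divide_distrib[symmetric])
    ultimately have "((\<lambda>t. f p (a + t * (y - a))) has_integral
        integral {a..y} (f p) / (y - a)) {0..1}"
      using that by (simp add: algebra_simps)
    then show ?thesis using False by (simp add: integral_unique)
  qed simp
  have "continuous_on (UNIV \<times> cbox 0 1)
     (\<lambda>(z, t). f (fst z) (a + t * (max a (snd z) - a)))"
    unfolding case_prod_beta
    by (rule continuous_on_compose2[OF assms,
          of _ "\<lambda>w. (fst (fst w), a + snd w * (max a (snd (fst w)) - a))", simplified])
      (intro continuous_intros)
  then have "continuous_on UNIV
     (\<lambda>z. integral (cbox 0 1) (\<lambda>t. f (fst z) (a + t * (max a (snd z) - a))))"
    by (rule integral_continuous_on_param)
  then have "continuous_on UNIV (\<lambda>z. (max a (snd z) - a) *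
      integral {0..1} (\<lambda>t. f (fst z) (a + t * (max a (snd z) - a))))"
    by (intro continuous_intros) simp
  then show ?thesis by (simp add: *)
qed

lemma DERIV2_nonneg_at_local_min:
  fixes f :: "real \<Rightarrow> real"
  assumes f: "\<And>y. a < y \<Longrightarrow> y < e \<Longrightarrow> (f has_real_derivative f' y) (at y)"
    and f': "(f' has_real_derivative l) (at x)"
    and x: "a < x" "x < e"
    and min: "\<And>y. a < y \<Longrightarrow> y < e \<Longrightarrow> f x \<le> f y"
  shows "f' x = 0" "l \<ge> 0"
proof -
  define r where "r = min (x - a) (e - x)"
  have r: "r > 0" using x by (simp add: r_def)
  show 0: "f' x = 0"
    by (rule DERIV_local_min[OF f[OF x] r]) (auto simp: r_def intro!: min)
  show "l \<ge> 0"
  proof (rule ccontr)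
    assume "\<not> l \<ge> 0"
    then obtain h where h: "h > 0" "\<And>k. 0 < k \<Longrightarrow> k < h \<Longrightarrow> f' (x + k) < 0"
      using DERIV_neg_dec_right[OF f'] 0 by auto
    define k where "k = min h (e - x) / 2"
    have k: "0 < k" "k < h" "x + k < e" using h x by (auto simp: k_def min_def field_simps)
    have "f (x + k) < f x"
    proof (rule DERIV_neg_imp_decreasing_open[of x "x + k" f])
      show "x < x + k" using k by simp
      fix y assume y: "x < y" "y < x + k"
      then show "\<exists>z. (f has_real_derivative z) (at y) \<and> z < 0"
        using h(2)[of "y - x"] f[of y] x k by auto
    next
      show "continuous_on {x..x + k} f"
        using x k by (intro continuous_at_imp_continuous_on ballI DERIV_isCont[OF f]) auto
    qed
    then show False using min[of "x + k"] x k by auto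
  qed
qed

text \<open>At a negative interior minimum \<open>w' = 0\<close>, \<open>w'' \<ge> 0\<close> and
  \<open>- d * w > 0\<close>, against \<open>ineq\<close>. Asking for \<open>ineq\<close> only where
  \<open>w < 0\<close> matters for the lower barrier, whose differential inequality is available
  only where it is positive.\<close>

lemma nonneg_by_maximum_principle:
  fixes w :: "real \<Rightarrow> real"
  assumes cont: "continuous_on {a..e} w" and "a \<le> e" and ends: "w a \<ge> 0" "w e \<ge> 0"
    and w: "\<And>y. a < y \<Longrightarrow> y < e \<Longrightarrow> (w has_real_derivative w' y) (at y)"
    and w': "\<And>y. a < y \<Longrightarrow> y < e \<Longrightarrow> (w' has_real_derivative w'' y) (at y)"
    and ineq: "\<And>y. a < y \<Longrightarrow> y < e \<Longrightarrow> w y < 0 \<Longrightarrow> w'' y - c * w' y - d * w y \<le> 0"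
    and "d > 0" and x: "a \<le> x" "x \<le> e"
  shows "w x \<ge> 0"
proof (rule ccontr)
  assume neg: "\<not> w x \<ge> 0"
  obtain y where y: "y \<in> {a..e}" "\<And>z. z \<in> {a..e} \<Longrightarrow> w y \<le> w z"
    using continuous_attains_inf[OF _ _ cont] \<open>a \<le> e\<close> by auto
  have wy: "w y < 0" using y(2)[of x] x neg by auto
  with ends y(1) have ay: "a < y" "y < e" by (auto simp: less_le)
  have "w' y = 0" "w'' y \<ge> 0"
    using DERIV2_nonneg_at_local_min[OF w w'[OF ay] ay] y(2) by auto
  moreover have "d * w y < 0" using wy \<open>d > 0\<close> by (simp add: mult_pos_neg)
  ultimately show False using ineq[OF ay wy] by auto
qed

section \<open>Variation of constants and shooting for the linear equation\<close>

locale char_roots =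
  fixes c d :: real
  assumes d_pos: "d > 0"
begin

definition mu1 where "mu1 = (c - sqrt (c\<^sup>2 + 4 * d)) / 2"
definition mu2 where "mu2 = (c + sqrt (c\<^sup>2 + 4 * d)) / 2"

lemma sqrt_sq: "sqrt (c\<^sup>2 + 4 * d) * sqrt (c\<^sup>2 + 4 * d) = c\<^sup>2 + 4 * d"
  using d_pos by (intro real_sqrt_mult_self[THEN trans]) simp

lemma mu_less: "mu1 < mu2"
  using d_pos by (simp add: mu1_def mu2_def add_nonneg_pos)

lemma mu_sum: "mu1 + mu2 = c"
  by (simp add: mu1_def mu2_def field_simps)

lemma mu_prod: "mu1 * mu2 = - d"
  using sqrt_sq by (simp add: mu1_def mu2_def power2_eq_square algebra_simps)

lemma mu_char: "mu1 * mu1 = c * mu1 + d" "mu2 * mu2 = c * mu2 + d"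
proof -
  have "(mu1 + mu2) * m = c * m" for m by (simp only: mu_sum)
  from this[of mu1] this[of mu2] show "mu1 * mu1 = c * mu1 + d" "mu2 * mu2 = c * mu2 + d"
    using mu_prod by (simp_all add: algebra_simps)
qed

text \<open>The solution of \<open>w' = m * w + g\<close> that vanishes at a. The operator factors
  through the roots mu1 and mu2, so the difference of two such solutions, divided by
  \<open>mu2 - mu1\<close>, handles the second-order equation.\<close>

definition duhamel :: "real \<Rightarrow> real \<Rightarrow> (real \<Rightarrow> real) \<Rightarrow> real \<Rightarrow> real" where
  "duhamel m a g x = exp (m * x) * integral {a..x} (\<lambda>s. exp (- m * s) * g s)"

text \<open>Variation of constants for $w'' - c w' - d w = -g$ to the right of \<open>a\<close>, with value \<open>h\<close> at \<open>a\<close>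
  and the slope at \<open>a\<close> controlled by \<open>p\<close>.\<close>

definition shot :: "real \<Rightarrow> real \<Rightarrow> real \<Rightarrow> (real \<Rightarrow> real) \<Rightarrow> real \<Rightarrow> real" where
  "shot a h p g x = h * exp (mu2 * (x - a)) + p * (exp (mu2 * (x - a)) - exp (mu1 * (x - a)))
     - (duhamel mu2 a g x - duhamel mu1 a g x) / (mu2 - mu1)"

definition shot' :: "real \<Rightarrow> real \<Rightarrow> real \<Rightarrow> (real \<Rightarrow> real) \<Rightarrow> real \<Rightarrow> real" where
  "shot' a h p g x = h * (mu2 * exp (mu2 * (x - a)))
     + p * (mu2 * exp (mu2 * (x - a)) - mu1 * exp (mu1 * (x - a)))
     - (mu2 * duhamel mu2 a g x - mu1 * duhamel mu1 a g x) / (mu2 - mu1)"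

lemma shot_start [simp]: "shot a h p g a = h"
  by (simp add: shot_def duhamel_def)

lemma duhamel_DERIV:
  assumes "continuous_on UNIV g" "a < x"
  shows "(duhamel m a g has_real_derivative m * duhamel m a g x + g x) (at x)"
proof -
  have "continuous_on {a..x+1} (\<lambda>s. exp (- m * s) * g s)"
    using assms(1) by (intro continuous_intros) (auto intro: continuous_on_subset)
  then have "((\<lambda>x. integral {a..x} (\<lambda>s. exp (- m * s) * g s)) has_real_derivative
       exp (- m * x) * g x) (at x within {a..x+1})"
    using assms by (intro integral_has_real_derivative) auto
  moreover have "at x within {a..x+1} = at x"
    using assms by (intro at_within_interior) auto
  ultimately have "((\<lambda>x. integral {a..x} (\<lambda>s. exp (- m * s) * g s)) has_real_derivative
       exp (- m * x) * g x) (at x)" by simp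
  then have "((\<lambda>x. exp (m * x) * integral {a..x} (\<lambda>s. exp (- m * s) * g s))
           has_real_derivative
         exp (m * x) * m * integral {a..x} (\<lambda>s. exp (- m * s) * g s)
           + exp (- m * x) * g x * exp (m * x)) (at x)"
    by (intro DERIV_mult) (auto intro!: derivative_eq_intros)
  moreover have "exp (- m * x) * g x * exp (m * x) = g x"
    by (simp add: exp_minus)
  ultimately show ?thesis
    unfolding duhamel_def[abs_def] by (simp only: mult.commute[of "exp (m * x)" m] mult.assoc)
qed

lemma shot_DERIV:
  assumes "continuous_on UNIV g" "a < x"
  shows "(shot a h p g has_real_derivative shot' a h p g x) (at x)"
proof -
  have "(shot a h p g has_real_derivative
      h * (exp (mu2 * (x - a)) * mu2)
      + p * (exp (mu2 * (x - a)) * mu2 - exp (mu1 * (x - a)) * mu1)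
      - (mu2 * duhamel mu2 a g x + g x - (mu1 * duhamel mu1 a g x + g x)) / (mu2 - mu1)) (at x)"
    unfolding shot_def[abs_def]
    by (rule DERIV_diff DERIV_add DERIV_cmult DERIV_cdivide duhamel_DERIV[OF assms] |
        (auto intro!: derivative_eq_intros; fail))+
  then show ?thesis by (simp add: shot'_def mult.commute)
qed

lemma shot'_DERIV:
  assumes "continuous_on UNIV g" "a < x"
  shows "(shot' a h p g has_real_derivative c * shot' a h p g x + d * shot a h p g x - g x) (at x)"
proof -
  define I2 where "I2 = duhamel mu2 a g x"
  define I1 where "I1 = duhamel mu1 a g x"
  define E1 where "E1 = exp (mu1 * (x - a))"
  define E2 where "E2 = exp (mu2 * (x - a))"
  have "(shot' a h p g has_real_derivative
      h * (mu2 * (E2 * mu2)) + p * (mu2 * (E2 * mu2) - mu1 * (E1 * mu1))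
      - (mu2 * (mu2 * I2 + g x) - mu1 * (mu1 * I1 + g x)) / (mu2 - mu1)) (at x)"
    unfolding shot'_def[abs_def] E1_def E2_def I1_def I2_def
    by (rule DERIV_diff DERIV_add DERIV_cmult DERIV_cdivide duhamel_DERIV[OF assms] |
        (auto intro!: derivative_eq_intros; fail))+
  also have "h * (mu2 * (E2 * mu2)) + p * (mu2 * (E2 * mu2) - mu1 * (E1 * mu1))
      - (mu2 * (mu2 * I2 + g x) - mu1 * (mu1 * I1 + g x)) / (mu2 - mu1)
     = h * ((mu2 * mu2) * E2) + p * ((mu2 * mu2) * E2 - (mu1 * mu1) * E1)
      - ((mu2 * mu2) * I2 - (mu1 * mu1) * I1) / (mu2 - mu1) - g x"
  proof -
    \<comment> \<open>The boundary terms \<open>g x\<close> cancel in the first derivative; in the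
      second they carry the weights mu2 and mu1 and leave exactly one \<open>g x\<close>.\<close>
    have "(mu2 * g x - mu1 * g x) / (mu2 - mu1) = g x"
      using mu_less by (simp add: left_diff_distrib[symmetric])
    then have "(mu2 * (mu2 * I2 + g x) - mu1 * (mu1 * I1 + g x)) / (mu2 - mu1)
        = ((mu2 * mu2) * I2 - (mu1 * mu1) * I1) / (mu2 - mu1) + g x"
      by (simp add: algebra_simps add_divide_distrib diff_divide_distrib)
    then show ?thesis by (simp add: mult.commute mult.left_commute)
  qed
  also have "\<dots> = c * shot' a h p g x + d * shot a h p g x - g x"
    unfolding mu_char shot_def shot'_def I1_def[symmetric] I2_def[symmetric]
      E1_def[symmetric] E2_def[symmetric]
    by (simp add: algebra_simps add_divide_distrib diff_divide_distrib)
  finally show ?thesis .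
qed

text \<open>Joint continuity is needed because in the method of steps the forcing itself depends on
  the slope parameter. \<open>max a\<close> extends the solution constantly to the left of a, which
  makes the claim one about the whole plane.\<close>

lemma continuous_on_shot:
  fixes g :: "real \<Rightarrow> real \<Rightarrow> real"
  assumes "continuous_on UNIV (\<lambda>z. g (fst z) (snd z))"
  shows "continuous_on UNIV (\<lambda>z. shot a h (fst z) (g (fst z)) (max a (snd z)))"
proof -
  have "continuous_on UNIV (\<lambda>z. integral {a..max a (snd z)} (\<lambda>s. exp (- m * s) * g (fst z) s))"
    for m
    using assms
    by (intro continuous_on_indefinite_integral[where f = "\<lambda>p s. exp (- m * s) * g p s"]
        continuous_intros)
  then show ?thesis
    unfolding shot_def duhamel_def using mu_less by (intro continuous_intros) auto
qed

lemma shot_cong: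
  assumes "\<And>s. a \<le> s \<Longrightarrow> s \<le> x \<Longrightarrow> g s = g' s"
  shows "shot a h p g x = shot a h p g' x"
proof -
  have "integral {a..x} (\<lambda>s. exp (- m * s) * g s) = integral {a..x} (\<lambda>s. exp (- m * s) * g' s)" for m
    using assms by (intro integral_cong) auto
  then show ?thesis by (simp only: shot_def duhamel_def)
qed

text \<open>The forcing is bounded uniformly in p, so the value at x is \<open>p * A\<close> up to
  an error at most C, with \<open>A > 0\<close> because \<open>mu1 < mu2\<close>. Slopes with
  \<open>P * A = \<bar>y\<bar> + C\<close> overshoot and undershoot y.\<close>

lemma shot_hits:
  fixes g :: "real \<Rightarrow> real \<Rightarrow> real"
  assumes cont: "continuous_on UNIV (\<lambda>p. shot a h p (g p) x)" and ax: "a < x"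
    and gcont: "\<And>p. continuous_on UNIV (g p)"
    and bound: "\<And>p s. \<bar>g p s\<bar> \<le> B"
  obtains p where "shot a h p (g p) x = y"
proof -
  define A where "A = exp (mu2 * (x - a)) - exp (mu1 * (x - a))"
  have A: "A > 0" using ax mu_less by (simp add: A_def)
  have B: "B \<ge> 0" using bound[of 0 0] by linarith
  have int: "\<exists>C. \<forall>p. \<bar>integral {a..x} (\<lambda>s. exp (- m * s) * g p s)\<bar> \<le> C" for m
  proof -
    have "continuous_on {a..x} (\<lambda>s. exp (- m * s))" by (intro continuous_intros)
    then have "bounded ((\<lambda>s. exp (- m * s)) ` {a..x})"
      by (intro compact_imp_bounded compact_continuous_image) auto
    then obtain E where E: "\<And>s. s \<in> {a..x} \<Longrightarrow> norm (exp (- m * s)) \<le> E"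
      unfolding bounded_iff by blast
    have "norm (integral {a..x} (\<lambda>s. exp (- m * s) * g p s)) \<le> (E * B) * (x - a)" for p
    proof (rule integral_bound)
      show "continuous_on {a..x} (\<lambda>s. exp (- m * s) * g p s)"
        using gcont by (intro continuous_intros) (auto intro: continuous_on_subset)
      show "norm (exp (- m * s) * g p s) \<le> E * B" if "s \<in> {a..x}" for s
        unfolding norm_mult using E[OF that] bound[of p s] norm_ge_zero[of "exp (- m * s)"]
        by (intro mult_mono) (auto intro: order_trans[OF exp_ge_zero])
    qed (use ax in simp)
    then show ?thesis by auto
  qed
  obtain C1 where C1: "\<And>p. \<bar>integral {a..x} (\<lambda>s. exp (- mu1 * s) * g p s)\<bar> \<le> C1"
    using int by blast
  obtain C2 where C2: "\<And>p. \<bar>integral {a..x} (\<lambda>s. exp (- mu2 * s) * g p s)\<bar> \<le> C2"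
    using int by blast
  define C where "C = \<bar>h * exp (mu2 * (x - a))\<bar> + (exp (mu2 * x) * C2 + exp (mu1 * x) * C1) / (mu2 - mu1)"
  have near: "\<bar>shot a h p (g p) x - p * A\<bar> \<le> C" for p
  proof -
    define J where "J = exp (mu2 * x) * integral {a..x} (\<lambda>s. exp (- mu2 * s) * g p s)
        - exp (mu1 * x) * integral {a..x} (\<lambda>s. exp (- mu1 * s) * g p s)"
    have "\<bar>J\<bar> \<le> \<bar>exp (mu2 * x) * integral {a..x} (\<lambda>s. exp (- mu2 * s) * g p s)\<bar>
        + \<bar>exp (mu1 * x) * integral {a..x} (\<lambda>s. exp (- mu1 * s) * g p s)\<bar>"
      unfolding J_def by (rule abs_triangle_ineq4)
    also have "\<dots> \<le> exp (mu2 * x) * C2 + exp (mu1 * x) * C1"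
      unfolding abs_mult using C1[of p] C2[of p] by (intro add_mono mult_mono) auto
    finally have "\<bar>J / (mu2 - mu1)\<bar> \<le> (exp (mu2 * x) * C2 + exp (mu1 * x) * C1) / (mu2 - mu1)"
      using mu_less by (simp add: abs_divide divide_right_mono)
    moreover have "shot a h p (g p) x - p * A = h * exp (mu2 * (x - a)) - J / (mu2 - mu1)"
      by (simp add: shot_def duhamel_def A_def J_def)
    ultimately show ?thesis unfolding C_def by linarith
  qed
  define P where "P = (\<bar>y\<bar> + C) / A"
  have PA: "P * A = \<bar>y\<bar> + C" using A by (simp add: P_def)
  have "C \<ge> 0" using near[of 0] by linarith
  then have "P \<ge> 0" using A by (simp add: P_def)
  have "shot a h (-P) (g (-P)) x \<le> y" "y \<le> shot a h P (g P) x"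
    using near[of P] near[of "-P"] PA by auto
  then have "\<exists>p. - P \<le> p \<and> p \<le> P \<and> shot a h p (g p) x = y"
    using \<open>P \<ge> 0\<close> cont by (intro IVT') (auto intro: continuous_on_subset)
  then show ?thesis using that by blast
qed

end

section \<open>Uniform limits on compact intervals\<close>

text \<open>Arzela-Ascoli on each [-i, i], then a diagonal subsequence. The codomain is general so
  that a function and its derivative, taken as a pair, converge along the same subsequence.\<close>

lemma lipschitz_sequence_compact:
  fixes F :: "nat \<Rightarrow> real \<Rightarrow> 'b::{real_normed_vector,heine_borel}"
  assumes bound: "\<And>n x. norm (F n x) \<le> B"
    and lip: "\<And>n x y. norm (F n x - F n y) \<le> C * \<bar>x - y\<bar>"
  obtains G k where "strict_mono (k :: nat \<Rightarrow> nat)"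
    "\<And>r. uniform_limit {-r..r} (\<lambda>n. F (k n)) G sequentially"
proof -
  define P where "P i r \<longleftrightarrow> (\<exists>g. uniform_limit {-real i..real i} (\<lambda>n. F (r n)) g sequentially)"
    for i :: nat and r :: "nat \<Rightarrow> nat"
  have C: "C \<ge> 0" using order_trans[OF norm_ge_zero lip[of 0 1 0]] by simp
  have sub: "\<exists>k. strict_mono (k :: nat \<Rightarrow> nat) \<and> P i (r \<circ> k)" for i r
  proof -
    obtain g k where gk: "strict_mono (k :: nat \<Rightarrow> nat)"
      "\<And>e. 0 < e \<Longrightarrow> \<exists>N. \<forall>n x. n \<ge> N \<and> x \<in> {-real i..real i} \<longrightarrow> norm (F (r (k n)) x - g x) < e"
    proof (rule Arzela_Ascoli[of "{-real i..real i}" "\<lambda>n. F (r n)" B])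
      show "\<exists>d>0. \<forall>n y. y \<in> {-real i..real i} \<and> norm (x - y) < d \<longrightarrow>
          norm (F (r n) x - F (r n) y) < e" if "e > 0" for x e
      proof (intro exI[of _ "e / (C + 1)"] conjI allI impI)
        fix n y assume "y \<in> {-real i..real i} \<and> norm (x - y) < e / (C + 1)"
        then have "(C + 1) * \<bar>x - y\<bar> < e" using C by (simp add: field_simps)
        then have "C * \<bar>x - y\<bar> < e" using abs_ge_zero[of "x - y"] by (simp add: algebra_simps)
        then show "norm (F (r n) x - F (r n) y) < e" using lip[of "r n" x y] by simp
      qed (use that C in auto)
    qed (use bound in auto)
    then have "uniform_limit {-real i..real i} (\<lambda>n. F ((r \<circ> k) n)) g sequentially"
      unfolding uniform_limit_sequentially_iff dist_norm by fastforce
    with gk(1) show ?thesis unfolding P_def by blast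
  qed
  obtain k where k: "strict_mono (k :: nat \<Rightarrow> nat)" "\<And>i. P i (id \<circ> k)"
  proof (rule subsequence_diagonalization_lemma[of P id, OF sub])
    fix i N and r k1 k2 :: "nat \<Rightarrow> nat"
    assume 1: "P i (r \<circ> k1)" and 2: "\<And>j. N \<le> j \<Longrightarrow> \<exists>j'\<ge>j. k2 j = k1 j'"
    then obtain g where g: "uniform_limit {-real i..real i} (\<lambda>n. F (r (k1 n))) g sequentially"
      by (auto simp: P_def)
    have "uniform_limit {-real i..real i} (\<lambda>n. F (r (k2 n))) g sequentially"
      unfolding uniform_limit_sequentially_iff
    proof (intro allI impI)
      fix e :: real assume "e > 0"
      then obtain M where M: "\<forall>n\<ge>M. \<forall>x\<in>{-real i..real i}. dist (F (r (k1 n)) x) (g x) < e"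
        using g unfolding uniform_limit_sequentially_iff by blast
      show "\<exists>M. \<forall>n\<ge>M. \<forall>x\<in>{-real i..real i}. dist (F (r (k2 n)) x) (g x) < e"
        using M 2 by (intro exI[of _ "max M N"]) (metis max.bounded_iff order_trans)
    qed
    then show "P i (r \<circ> k2)" by (auto simp: P_def)
  qed blast
  then obtain g where g: "\<And>i. uniform_limit {-real i..real i} (\<lambda>n. F (k n)) (g i) sequentially"
    unfolding P_def comp_def id_def by metis
  \<comment> \<open>The limits \<open>g i\<close> on the different intervals are pointwise limits of
    one sequence, hence restrictions of this G.\<close>
  define G where "G x = lim (\<lambda>n. F (k n) x)" for x
  have G: "g i x = G x" if "x \<in> {-real i..real i}" for i x
    using limI[OF tendsto_uniform_limitI[OF g that]] by (simp add: G_def)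
  have "uniform_limit {-r..r} (\<lambda>n. F (k n)) G sequentially" for r
  proof -
    obtain i :: nat where "r \<le> i" using real_arch_simple by blast
    moreover have "uniform_limit {-real i..real i} (\<lambda>n. F (k n)) G sequentially"
      using g[of i] G by (rule_tac uniform_limit_cong'[THEN iffD1]) auto
    ultimately show ?thesis by (elim uniform_limit_on_subset) auto
  qed
  with k(1) show ?thesis by (rule that)
qed

text \<open>Each approximation is differentiable only on its own bounded interval, so on a fixed
  interval this holds only from some index N on; the sequence is shifted by N before the limit
  theorem is applied.\<close>

lemma uniform_limit_DERIV:
  fixes f f' :: "nat \<Rightarrow> real \<Rightarrow> real"
  assumes der: "\<forall>\<^sub>F n in sequentially. \<forall>x\<in>{-r..r}. (f n has_real_derivative f' n x) (at x)"
    and f: "uniform_limit {-r..r} f g sequentially"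
    and f': "uniform_limit {-r..r} f' g' sequentially"
    and x: "\<bar>x\<bar> < r"
  shows "(g has_real_derivative g' x) (at x)"
proof -
  obtain N where N: "\<And>n x. n \<ge> N \<Longrightarrow> x \<in> {-r..r} \<Longrightarrow> (f n has_real_derivative f' n x) (at x)"
    using der unfolding eventually_sequentially by blast
  have x_in: "x \<in> {-r..r}" using x by auto
  have "\<exists>h. \<forall>x\<in>{-r..r}. (\<lambda>n. f (n + N) x) \<longlonglongrightarrow> h x \<and>
      (h has_derivative (\<lambda>y. g' x * y)) (at x within {-r..r})"
  proof (rule has_derivative_sequence[where ?x0.0 = x and l = "g x" and f' = "\<lambda>n x y. f' (n + N) x * y"])
    show "(f (n + N) has_derivative (\<lambda>y. f' (n + N) x * y)) (at x within {-r..r})"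
      if "x \<in> {-r..r}" for n x
      using N[of "n + N" x] that
      by (auto simp: has_field_derivative_def intro: has_derivative_at_withinI)
    show "\<forall>\<^sub>F n in sequentially. \<forall>x\<in>{-r..r}. \<forall>h. norm (f' (n + N) x * h - g' x * h) \<le> e * norm h"
      if "e > 0" for e
    proof -
      have "\<forall>\<^sub>F n in sequentially. \<forall>x\<in>{-r..r}. dist (f' n x) (g' x) < e"
        using uniform_limitD[OF f' that] .
      then have "\<forall>\<^sub>F n in sequentially. \<forall>x\<in>{-r..r}. dist (f' (n + N) x) (g' x) < e"
        by (rule eventually_sequentially_seg[THEN iffD2])
      then show ?thesis
      proof (rule eventually_mono, intro ballI allI)
        fix n x h assume "\<forall>x\<in>{-r..r}. dist (f' (n + N) x) (g' x) < e" "x \<in> {-r..r}"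
        then have "\<bar>f' (n + N) x - g' x\<bar> * \<bar>h\<bar> \<le> e * \<bar>h\<bar>"
          by (intro mult_right_mono) (auto simp: dist_real_def intro: less_imp_le)
        then show "norm (f' (n + N) x * h - g' x * h) \<le> e * norm h"
          by (simp add: left_diff_distrib[symmetric] abs_mult)
      qed
    qed
    show "(\<lambda>n. f (n + N) x) \<longlonglongrightarrow> g x"
      by (intro LIMSEQ_ignore_initial_segment tendsto_uniform_limitI[OF f x_in])
  qed (use x_in in auto)
  then obtain h where h: "\<And>x. x \<in> {-r..r} \<Longrightarrow> (\<lambda>n. f (n + N) x) \<longlonglongrightarrow> h x"
    "\<And>x. x \<in> {-r..r} \<Longrightarrow> (h has_derivative (\<lambda>y. g' x * y)) (at x within {-r..r})"
    by blast
  have "h y = g y" if "y \<in> {-r..r}" for y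
    using LIMSEQ_unique[OF h(1)[OF that]
        LIMSEQ_ignore_initial_segment[OF tendsto_uniform_limitI[OF f that]]] .
  then have "(g has_derivative (\<lambda>y. g' x * y)) (at x within {-r..r})"
    using has_derivative_transform[OF x_in _ h(2)[OF x_in], of g] by auto
  moreover have "at x within {-r..r} = at x"
    using x by (intro at_within_interior) auto
  ultimately show ?thesis by (simp add: has_field_derivative_def)
qed

text \<open>The state dependence moves the evaluation point itself. With y and z the points for
  \<open>u n\<close> and for v, the error splits into \<open>u n y - v y\<close>, which is uniformly
  small, and \<open>v y - v z\<close>, which the Lipschitz bound on the limit controls through
  \<open>y - z\<close>.\<close>

lemma uniform_limit_delayed_argument:
  fixes u :: "nat \<Rightarrow> real \<Rightarrow> real"
  assumes u: "\<And>r. uniform_limit {-r..r} u v sequentially"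
    and lip: "\<And>x y. \<bar>v x - v y\<bar> \<le> C * \<bar>x - y\<bar>"
    and e: "e \<longlonglongrightarrow> 0" "\<And>n. 0 \<le> e n" "\<And>n. e n \<le> 1"
    and u_range: "\<And>n x. u n x \<in> {0..U}" and v_range: "\<And>x. v x \<in> {0..U}"
    and tau: "\<And>x. x \<in> {0..U} \<Longrightarrow> \<tau> x \<in> {0..T}"
    and tau_lip: "\<And>x y. x \<in> {0..U} \<Longrightarrow> y \<in> {0..U} \<Longrightarrow> \<bar>\<tau> x - \<tau> y\<bar> \<le> \<bar>x - y\<bar>"
    and c: "c \<ge> 0"
  shows "uniform_limit {-r..r} (\<lambda>n x. u n (x - e n - c * \<tau> (u n (x - e n))))
           (\<lambda>x. v (x - c * \<tau> (v x))) sequentially"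
  unfolding uniform_limit_iff
proof (intro allI impI)
  fix \<epsilon> :: real assume \<epsilon>: "\<epsilon> > 0"
  have C: "C \<ge> 0" using lip[of 1 0] abs_ge_zero[of "v 1 - v 0"] by simp
  \<comment> \<open>If \<open>u n\<close> is \<delta>-close to v and \<open>e n < \<delta>\<close>,
    then the arguments of \<tau> differ by at most \<delta> (1 + C), the evaluation points by
    \<delta> (1 + c (1 + C)), and the values by \<delta> Q.\<close>
  define Q where "Q = 1 + C * (1 + c * (1 + C))"
  have Q: "Q > 0" using C c by (simp add: Q_def add_pos_nonneg)
  define \<delta> where "\<delta> = \<epsilon> / Q"
  have \<delta>: "\<delta> > 0" using \<epsilon> Q by (simp add: \<delta>_def)
  \<comment> \<open>Room for the shift by \<open>e n\<close>, at most 1, and for the delay, at most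
    c T: all evaluation points stay in [-r', r'].\<close>
  define r' where "r' = r + 1 + c * T"
  have "\<forall>\<^sub>F n in sequentially. e n < \<delta>"
    using order_tendstoD(2)[OF e(1) \<delta>] .
  moreover have "\<forall>\<^sub>F n in sequentially. \<forall>x\<in>{-r'..r'}. dist (u n x) (v x) < \<delta>"
    using uniform_limitD[OF u \<delta>] .
  ultimately show "\<forall>\<^sub>F n in sequentially. \<forall>x\<in>{-r..r}.
      dist (u n (x - e n - c * \<tau> (u n (x - e n)))) (v (x - c * \<tau> (v x))) < \<epsilon>"
  proof (eventually_elim, intro ballI)
    fix n x assume en: "e n < \<delta>" and near: "\<forall>x\<in>{-r'..r'}. dist (u n x) (v x) < \<delta>"
      and x: "x \<in> {-r..r}"
    define y where "y = x - e n - c * \<tau> (u n (x - e n))"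
    define z where "z = x - c * \<tau> (v x)"
    have "\<tau> (u n (x - e n)) \<in> {0..T}" by (intro tau u_range)
    then have ct: "0 \<le> c * \<tau> (u n (x - e n))" "c * \<tau> (u n (x - e n)) \<le> c * T" "0 \<le> c * T"
      using c by (auto intro: mult_left_mono)
    have 1: "\<bar>u n (x - e n) - v (x - e n)\<bar> < \<delta>"
      using near x e(2,3)[of n] ct by (auto simp: r'_def dist_real_def)
    have 2: "\<bar>u n y - v y\<bar> < \<delta>"
      using near x e(2,3)[of n] ct by (auto simp: r'_def y_def dist_real_def)
    have "\<bar>v (x - e n) - v x\<bar> \<le> C * \<delta>"
      using lip[of "x - e n" x] e(2)[of n] mult_left_mono[of "e n" \<delta> C] en C by simp
    with 1 have "\<bar>u n (x - e n) - v x\<bar> \<le> \<delta> * (1 + C)" by (simp add: algebra_simps)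
    then have "\<bar>\<tau> (u n (x - e n)) - \<tau> (v x)\<bar> \<le> \<delta> * (1 + C)"
      using tau_lip[OF u_range[of n "x - e n"] v_range[of x]] by linarith
    then have "\<bar>c * (\<tau> (u n (x - e n)) - \<tau> (v x))\<bar> \<le> c * (\<delta> * (1 + C))"
      using c unfolding abs_mult by (intro mult_mono) auto
    moreover have "y - z = - e n - c * (\<tau> (u n (x - e n)) - \<tau> (v x))"
      by (simp add: y_def z_def algebra_simps)
    ultimately have "\<bar>y - z\<bar> \<le> \<delta> * (1 + c * (1 + C))"
      using en e(2)[of n] by (simp add: algebra_simps)
    then have "C * \<bar>y - z\<bar> \<le> C * (\<delta> * (1 + c * (1 + C)))"
      using C by (intro mult_left_mono)
    then have "\<bar>v y - v z\<bar> \<le> C * (\<delta> * (1 + c * (1 + C)))"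
      using lip[of y z] by linarith
    moreover have "\<delta> + C * (\<delta> * (1 + c * (1 + C))) = \<delta> * Q" by (simp add: Q_def algebra_simps)
    moreover have "\<delta> * Q = \<epsilon>" using Q by (simp add: \<delta>_def)
    ultimately show "dist (u n (x - e n - c * \<tau> (u n (x - e n)))) (v (x - c * \<tau> (v x))) < \<epsilon>"
      using 2 unfolding dist_real_def y_def[symmetric] z_def[symmetric] by linarith
  qed
qed

section \<open>A priori bound on the slope\<close>

lemma lipschitz_by_DERIV:
  fixes f :: "real \<Rightarrow> real"
  assumes f: "\<And>x. a \<le> x \<Longrightarrow> x \<le> b \<Longrightarrow> (f has_real_derivative f' x) (at x)"
    and bound: "\<And>x. a \<le> x \<Longrightarrow> x \<le> b \<Longrightarrow> \<bar>f' x\<bar> \<le> C"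
    and "x \<in> {a..b}" "y \<in> {a..b}"
  shows "\<bar>f x - f y\<bar> \<le> C * \<bar>x - y\<bar>"
proof -
  have "norm (f x - f y) \<le> C * norm (x - y)"
    by (rule field_differentiable_bound[of "{a..b}" f f'])
      (use assms in \<open>auto intro: has_field_derivative_at_within\<close>)
  then show ?thesis by simp
qed

text \<open>The mean value theorem on a unit interval containing x yields z with
  \<open>\<bar>f' z\<bar> \<le> U\<close>. From z to x the quantity
  \<open>exp (- c * t) * f' t\<close> changes only through its derivative
  \<open>exp (- c * t) * g t\<close>. The resulting bound is the same for all R, as compactness
  requires.\<close>

lemma slope_bound:
  fixes f :: "real \<Rightarrow> real"
  assumes c: "c > 0" and R: "R \<ge> 1" and cont: "continuous_on {-R..R} f"
    and f: "\<And>x. -R < x \<Longrightarrow> x < R \<Longrightarrow> (f has_real_derivative f' x) (at x)"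
    and f': "\<And>x. -R < x \<Longrightarrow> x < R \<Longrightarrow> (f' has_real_derivative c * f' x + g x) (at x)"
    and f_range: "\<And>x. -R \<le> x \<Longrightarrow> x \<le> R \<Longrightarrow> f x \<in> {0..U}"
    and g: "\<And>x. -R < x \<Longrightarrow> x < R \<Longrightarrow> \<bar>g x\<bar> \<le> B"
    and x: "-R < x" "x < R"
  shows "\<bar>f' x\<bar> \<le> exp c * (U + B)"
proof -
  have mv: "\<exists>z. -R < z \<and> z < R \<and> \<bar>z - x\<bar> \<le> 1 \<and> \<bar>f' z\<bar> \<le> U"
  proof -
    \<comment> \<open>Going towards the origin keeps the unit interval inside [-R, R], since
      \<open>R \<ge> 1\<close>.\<close>
    define s where "s = (if x \<le> 0 then x else x - 1)"
    have s: "-R \<le> s" "s + 1 \<le> R" "s \<le> x" "x \<le> s + 1" using x R by (auto simp: s_def)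
    have "\<exists>l z. s < z \<and> z < s + 1 \<and> DERIV f z :> l \<and> f (s + 1) - f s = (s + 1 - s) * l"
    proof (rule MVT)
      show "continuous_on {s..s + 1} f" using cont s by (auto elim: continuous_on_subset)
      show "f differentiable (at z)" if "s < z" "z < s + 1" for z
        using f[of z] s that by (auto simp: real_differentiable_def)
    qed simp
    then obtain l z where z: "s < z" "z < s + 1" "DERIV f z :> l" "f (s + 1) - f s = l" by auto
    have "l = f' z" using DERIV_unique[OF z(3) f[of z]] z s by simp
    moreover have "\<bar>f (s + 1) - f s\<bar> \<le> U"
      using f_range[of s] f_range[of "s + 1"] s by auto
    ultimately show ?thesis using z s by (intro exI[of _ z]) auto
  qed
  then obtain z where z: "-R < z" "z < R" "\<bar>z - x\<bar> \<le> 1" "\<bar>f' z\<bar> \<le> U" by blast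
  define y where "y t = exp (- c * t) * f' t" for t
  define m where "m = min x z"
  have B: "B \<ge> 0" using g[of 0] R by simp
  have m: "exp (c * x) * exp (- c * m) \<le> exp c" "exp (c * x) * exp (- c * z) \<le> exp c"
  proof -
    have "c * (x - m) \<le> c * 1" "c * (x - z) \<le> c * 1"
      using c z by (auto intro!: mult_left_mono simp: m_def)
    then show "exp (c * x) * exp (- c * m) \<le> exp c" "exp (c * x) * exp (- c * z) \<le> exp c"
      by (simp_all add: exp_add[symmetric] algebra_simps)
  qed
  have "\<bar>y x - y z\<bar> \<le> (exp (- c * m) * B) * \<bar>x - z\<bar>"
  proof (rule lipschitz_by_DERIV[where a = m and b = "max x z" and f' = "\<lambda>t. exp (- c * t) * g t"])
    fix t assume t: "m \<le> t" "t \<le> max x z"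
    then have tR: "-R < t" "t < R" using x z by (auto simp: m_def)
    show "(y has_real_derivative exp (- c * t) * g t) (at t)"
      unfolding y_def using f'[OF tR] by (auto intro!: derivative_eq_intros simp: algebra_simps)
    show "\<bar>exp (- c * t) * g t\<bar> \<le> exp (- c * m) * B"
      unfolding abs_mult using g[OF tR] t c by (intro mult_mono) auto
  qed (auto simp: m_def)
  also have "\<dots> \<le> (exp (- c * m) * B) * 1"
    using z B by (intro mult_left_mono) auto
  finally have "\<bar>y x - y z\<bar> \<le> exp (- c * m) * B" by simp
  moreover have "\<bar>y z\<bar> \<le> exp (- c * z) * U"
    unfolding y_def abs_mult using z by (intro mult_mono) auto
  ultimately have "\<bar>y x\<bar> \<le> exp (- c * z) * U + exp (- c * m) * B" by linarith
  then have "exp (c * x) * \<bar>y x\<bar> \<le> exp (c * x) * (exp (- c * z) * U + exp (- c * m) * B)"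
    by (rule mult_left_mono) simp
  also have "\<dots> = (exp (c * x) * exp (- c * z)) * U + (exp (c * x) * exp (- c * m)) * B"
    by (simp add: algebra_simps)
  also have "\<dots> \<le> exp c * U + exp c * B"
    using m B z(4) by (intro add_mono mult_right_mono) auto
  finally have "exp (c * x) * \<bar>y x\<bar> \<le> exp c * (U + B)" by (simp add: algebra_simps)
  moreover have "exp (c * x) * \<bar>y x\<bar> = \<bar>f' x\<bar>"
    unfolding y_def abs_mult by (simp add: mult.assoc[symmetric] exp_add[symmetric])
  ultimately show ?thesis by simp
qed

section \<open>Positivity and persistence\<close>

text \<open>A strong maximum principle. At a zero x also \<open>f' x = 0\<close>. Factoring the
  operator by mu1 and mu2, \<open>exp (- mu1 * t) * (f' t - mu2 * f t)\<close> is nonincreasing and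
  vanishes at x, so it is nonnegative before x; then \<open>exp (- mu2 * t) * f t\<close> is
  nondecreasing there and ends at 0, which forces \<open>f \<le> 0\<close> on the whole left
  half-line.\<close>

lemma (in char_roots) supersolution_positive:
  assumes f: "\<And>x. (f has_real_derivative f' x) (at x)"
    and f': "\<And>x. (f' has_real_derivative f'' x) (at x)"
    and ineq: "\<And>x. f'' x - c * f' x - d * f x \<le> 0"
    and nonneg: "\<And>x. f x \<ge> 0" and pos: "\<And>y. \<exists>x\<le>y. f x > 0"
  shows "f x > 0"
proof (rule ccontr)
  assume "\<not> f x > 0"
  then have fx: "f x = 0" using nonneg[of x] by simp
  have f'x: "f' x = 0"
    by (rule DERIV_local_min[OF f, of 1]) (auto simp: fx nonneg)
  define w where "w t = exp (- mu1 * t) * (f' t - mu2 * f t)" for t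
  have eq: "f'' t - c * f' t - d * f t = f'' t - mu2 * f' t - mu1 * (f' t - mu2 * f t)" for t
  proof -
    have "(mu1 + mu2) * f' t = c * f' t" "mu1 * mu2 * f t = - d * f t"
      by (simp_all only: mu_sum mu_prod)
    then show ?thesis by (simp add: algebra_simps)
  qed
  have w_ineq: "f'' t - mu2 * f' t - mu1 * (f' t - mu2 * f t) \<le> 0" for t
    using ineq[of t] unfolding eq .
  have "w x \<le> w t" if "t \<le> x" for t
  proof (rule DERIV_nonpos_imp_nonincreasing[OF that])
    fix s
    have "(w has_real_derivative
        exp (- mu1 * s) * (f'' s - mu2 * f' s - mu1 * (f' s - mu2 * f s))) (at s)"
      unfolding w_def using f[of s] f'[of s] by (auto intro!: derivative_eq_intros simp: algebra_simps)
    then show "\<exists>y. (w has_real_derivative y) (at s) \<and> y \<le> 0"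
      using w_ineq[of s] by (auto intro!: exI mult_nonneg_nonpos)
  qed
  then have w: "f' t - mu2 * f t \<ge> 0" if "t \<le> x" for t
    using that by (simp add: w_def fx f'x zero_le_mult_iff)
  obtain t where t: "t \<le> x" "f t > 0" using pos by blast
  have "exp (- mu2 * t) * f t \<le> exp (- mu2 * x) * f x"
  proof (rule DERIV_nonneg_imp_nondecreasing[OF t(1)])
    fix s assume "t \<le> s" "s \<le> x"
    have "((\<lambda>s. exp (- mu2 * s) * f s) has_real_derivative
        exp (- mu2 * s) * (f' s - mu2 * f s)) (at s)"
      using f[of s] by (auto intro!: derivative_eq_intros simp: algebra_simps)
    then show "\<exists>y. ((\<lambda>s. exp (- mu2 * s) * f s) has_real_derivative y) (at s) \<and> 0 \<le> y"
      using w[OF \<open>s \<le> x\<close>] by (auto intro!: exI)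
  qed
  then show False using t(2) fx by (simp add: mult_le_0_iff)
qed

text \<open>At a minimum over the whole past the equation forces $d f \ge b(v)$ with $v \ge f$, which
  is impossible for small values. So once \<open>f\<close> drops below the threshold it is nonincreasing;
  then it is also concave and cannot stay positive.\<close>

lemma delayed_equation_persistence:
  fixes f s b :: "real \<Rightarrow> real"
  assumes f: "\<And>x. (f has_real_derivative f' x) (at x)"
    and f': "\<And>x. (f' has_real_derivative c * f' x + d * f x - b (f (x - s x))) (at x)"
    and f_pos: "\<And>x. 0 < f x" and f_le: "\<And>x. f x \<le> U" and c: "c > 0"
    and s: "\<And>x. 0 \<le> s x \<and> s x \<le> H"
    and "\<epsilon> > 0" and b: "\<And>u v. 0 < u \<Longrightarrow> u < \<epsilon> \<Longrightarrow> u \<le> v \<Longrightarrow> v \<le> U \<Longrightarrow> d * u < b v"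
  obtains \<delta> where "\<delta> > 0" "\<And>x. 0 \<le> x \<Longrightarrow> \<delta> \<le> f x"
proof -
  have H: "0 \<le> H" using s[of 0] by simp
  have cont: "continuous_on S f" for S
    using f by (intro continuous_at_imp_continuous_on ballI DERIV_isCont)
  obtain x0 where x0: "x0 \<in> {-H..0}" "\<And>y. y \<in> {-H..0} \<Longrightarrow> f x0 \<le> f y"
    using continuous_attains_inf[OF _ _ cont, of "{-H..0}"] H by auto
  \<comment> \<open>Below this level a minimum over [-H, y] cannot sit in [-H, 0]. It therefore lies
    at a positive point, from which the delayed argument still falls into [-H, y].\<close>
  define \<delta> where "\<delta> = min \<epsilon> (f x0)"
  have "\<delta> \<le> f x1" if x1: "0 \<le> x1" for x1
  proof (rule ccontr)
    assume "\<not> \<delta> \<le> f x1"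
    then have small: "f x1 < \<epsilon>" "f x1 < f x0" by (auto simp: \<delta>_def)
    have no_min: "\<not> (f z < \<delta> \<and> 0 < z \<and> z < y \<and> (\<forall>t\<in>{-H..y}. f z \<le> f t))" for y z
    proof
      assume z: "f z < \<delta> \<and> 0 < z \<and> z < y \<and> (\<forall>t\<in>{-H..y}. f z \<le> f t)"
      have min: "f z \<le> f t" if "-H < t" "t < y" for t using z that by auto
      have "- H < z" using z H by simp
      have "f' z = 0" "0 \<le> c * f' z + d * f z - b (f (z - s z))"
        by (rule DERIV2_nonneg_at_local_min[where a = "-H" and e = y and x = z and f = f and f' = f'
              and l = "c * f' z + d * f z - b (f (z - s z))"];
            use f f' min z \<open>- H < z\<close> in blast)+
      moreover have "d * f z < b (f (z - s z))"
        using z s[of z] by (intro b f_pos f_le) (auto simp: \<delta>_def)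
      ultimately show False by simp
    qed
    have le_past: "f y \<le> f t" if y: "f y < \<delta>" "0 \<le> y" and t: "t \<in> {-H..y}" for y t
    proof -
      obtain z where z: "z \<in> {-H..y}" "\<And>t. t \<in> {-H..y} \<Longrightarrow> f z \<le> f t"
        using continuous_attains_inf[OF _ _ cont, of "{-H..y}"] H y by auto
      have "f z < \<delta>" using z(2)[of y] y H by auto
      moreover have "0 < z"
        using x0(2)[of z] z(1) \<open>f z < \<delta>\<close> by (cases "z \<le> 0") (auto simp: \<delta>_def)
      ultimately have "z = y" using no_min[of z y] z by (auto simp: less_le)
      then show ?thesis using z(2) t by simp
    qed
    \<comment> \<open>A value above \<open>f x1\<close> at a later y would place the minimum over
      [-H, y] strictly before y, which \<open>no_min\<close> excludes.\<close>
    have below: "f y \<le> f x1" if x1y: "x1 \<le> y" for y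
    proof (rule ccontr)
      assume up: "\<not> f y \<le> f x1"
      obtain z where z: "z \<in> {-H..y}" "\<And>t. t \<in> {-H..y} \<Longrightarrow> f z \<le> f t"
        using continuous_attains_inf[OF _ _ cont, of "{-H..y}"] H x1 x1y by auto
      have "f z \<le> f x1" using z(2)[of x1] x1y x1 H by auto
      then have "f z < \<delta>" using small by (auto simp: \<delta>_def)
      moreover have "0 < z"
        using x0(2)[of z] z(1) \<open>f z < \<delta>\<close> by (cases "z \<le> 0") (auto simp: \<delta>_def)
      moreover have "z < y" using \<open>f z \<le> f x1\<close> up z(1) by (cases "z = y") auto
      ultimately show False using no_min[of z y] z by blast
    qed
    have past: "f y \<le> f t" if "x1 \<le> y" "t \<in> {-H..y}" for y t
      using le_past[of y t] below[of y] small x1 that by (auto simp: \<delta>_def)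
    have f'_nonpos: "f' y \<le> 0" if "x1 < y" for y
    proof (rule ccontr)
      assume "\<not> f' y \<le> 0"
      then obtain h where h: "h > 0" "\<And>k. 0 < k \<Longrightarrow> k < h \<Longrightarrow> f y < f (y + k)"
        using DERIV_pos_inc_right[OF f[of y]] by auto
      have "f (y + h / 2) \<le> f y" using that x1 H h(1) by (intro past) auto
      then show False using h(2)[of "h / 2"] h(1) by simp
    qed
    have f''_neg: "c * f' y + d * f y - b (f (y - s y)) < 0" if "x1 < y" for y
    proof -
      have "d * f y < b (f (y - s y))"
      proof (rule b[OF f_pos _ _ f_le])
        show "f y < \<epsilon>" using below[of y] that small by simp
        show "f y \<le> f (y - s y)" using that x1 s[of y] H by (intro past) auto
      qed
      moreover have "c * f' y \<le> 0" using f'_nonpos[OF that] c by (simp add: mult_nonneg_nonpos)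
      ultimately show ?thesis by simp
    qed
    \<comment> \<open>At \<open>x1 + 1\<close> the slope is already nonpositive; one more unit with
      negative second derivative makes it strictly negative.\<close>
    define y where "y = x1 + 2"
    have "f' y < f' (x1 + 1)"
    proof (rule DERIV_neg_imp_decreasing[where f = f'])
      show "\<exists>l. (f' has_real_derivative l) (at t) \<and> l < 0" if "x1 + 1 \<le> t" "t \<le> y" for t
        using f'[of t] f''_neg[of t] that by auto
    qed (simp add: y_def)
    then have neg: "f' y < 0" using f'_nonpos[of "x1 + 1"] by simp
    have slope: "f' t \<le> f' y" if "y \<le> t" for t
    proof (rule DERIV_nonpos_imp_nonincreasing[where f = f', OF that])
      show "\<exists>l. (f' has_real_derivative l) (at r) \<and> l \<le> 0" if "y \<le> r" for r
        using f'[of r] f''_neg[of r] that by (auto simp: y_def intro!: exI less_imp_le)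
    qed
    \<comment> \<open>The zero of the tangent at y; by concavity f lies below this tangent to the
      right of y.\<close>
    define T where "T = y + f y / (- f' y)"
    have T: "y < T" using neg f_pos[of y] by (simp add: T_def divide_pos_neg)
    have "\<exists>z>y. z < T \<and> f T - f y = (T - y) * f' z"
      using MVT2[OF T, of f f'] f by auto
    then obtain z where z: "y < z" "f T - f y = (T - y) * f' z" by blast
    have "(T - y) * f' z \<le> (T - y) * f' y"
      using slope[of z] z T by (intro mult_left_mono) auto
    also have "\<dots> = - f y" using neg by (simp add: T_def)
    finally have "f T \<le> 0" using z by simp
    then show False using f_pos[of T] by simp
  qed
  moreover have "\<delta> > 0" using \<open>\<epsilon> > 0\<close> f_pos by (simp add: \<delta>_def)
  ultimately show ?thesis using that by blast
qed

section \<open>Approximate waves between the barriers\<close>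

text \<open>\<open>b_le\<close> makes the constant U a supersolution. \<open>q_dom\<close> confines
  the positive part of the lower barrier to \<open>x \<le> 0\<close> and to values at most K, where
  \<open>b_ge_quadratic\<close> applies. In \<open>q_large\<close>,
  \<open>\<beta> * lam * (1 + c)\<close> is the price of replacing the delay by a constant and L
  that of linearizing b.\<close>

locale wave = char_roots +
  fixes U K L \<beta> lam nu q :: real and b \<tau> :: "real \<Rightarrow> real"
  assumes c_pos: "c > 0"
    and K_pos: "K > 0" and K_le_U: "K \<le> U"
    and beta_nonneg: "\<beta> \<ge> 0" and L_nonneg: "L \<ge> 0"
    and b_cont: "continuous_on {0..U} b"
    and b_nonneg: "0 \<le> u \<Longrightarrow> u \<le> U \<Longrightarrow> 0 \<le> b u"
    and b_le: "0 \<le> u \<Longrightarrow> u \<le> U \<Longrightarrow> b u \<le> d * U"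
    and b_le_linear: "0 \<le> u \<Longrightarrow> u \<le> U \<Longrightarrow> b u \<le> \<beta> * u"
    and b_ge_quadratic: "0 \<le> u \<Longrightarrow> u \<le> K \<Longrightarrow> \<beta> * u - L * u\<^sup>2 \<le> b u"
    and tau_0: "0 \<le> \<tau> 0" and tau_ge: "0 \<le> u \<Longrightarrow> \<tau> 0 \<le> \<tau> u"
    and tau_lipschitz: "0 \<le> u \<Longrightarrow> 0 \<le> v \<Longrightarrow> \<bar>\<tau> u - \<tau> v\<bar> \<le> \<bar>u - v\<bar>"
    and lam_pos: "0 < lam" and lam_less_nu: "lam < nu" and nu_less: "nu < 2 * lam"
    and char_lam: "char_fun d \<beta> (\<tau> 0) lam c = 0"
    and q_pos: "0 < q"
    and q_dom: "0 < exp (lam * x) - q * exp (nu * x) \<Longrightarrow> x \<le> 0 \<and> exp (lam * x) \<le> K"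
    and q_large: "\<beta> * lam * (1 + c) + L \<le> q * (- char_fun d \<beta> (\<tau> 0) nu c)"
begin

section \<open>Barriers and the clipped nonlinearity\<close>

definition lb0 :: "real \<Rightarrow> real" where "lb0 x = exp (lam * x) - q * exp (nu * x)"
definition lb :: "real \<Rightarrow> real" where "lb x = max 0 (lb0 x)"
definition ub :: "real \<Rightarrow> real" where "ub x = min U (exp (lam * x))"
definition clip :: "(real \<Rightarrow> real) \<Rightarrow> real \<Rightarrow> real" where "clip f x = max (lb x) (min (ub x) (f x))"

text \<open>The extra delay \<open>e\<close> makes the nonlinearity at \<open>x\<close> depend only on values of \<open>f\<close> on
  $(-\infty, x - e]$.\<close>

definition delayed :: "real \<Rightarrow> (real \<Rightarrow> real) \<Rightarrow> real \<Rightarrow> real" where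
  "delayed e f x = b (clip f (x - e - c * \<tau> (clip f (x - e))))"

lemma U_pos: "U > 0" using K_pos K_le_U by simp

lemma lb_nonneg [simp]: "0 \<le> lb x" by (simp add: lb_def)

lemma lb_le_ub: "lb x \<le> ub x"
proof -
  have "lb0 x \<le> exp (lam * x)" using q_pos by (simp add: lb0_def)
  moreover have "lb0 x \<le> U"
  proof (cases "0 < lb0 x")
    case True
    with q_dom[of x] \<open>lb0 x \<le> exp (lam * x)\<close> K_le_U show ?thesis by (simp add: lb0_def)
  qed (use U_pos in simp)
  ultimately show ?thesis using U_pos by (simp add: lb_def ub_def)
qed

lemma ub_le: "ub x \<le> U" "ub x \<le> exp (lam * x)" by (simp_all add: ub_def)

lemma clip_bounds: "lb x \<le> clip f x" "clip f x \<le> ub x"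
  using lb_le_ub[of x] by (auto simp: clip_def)

lemma clip_eq: "lb x \<le> f x \<Longrightarrow> f x \<le> ub x \<Longrightarrow> clip f x = f x"
  by (simp add: clip_def)

lemma clip_nonneg [simp]: "0 \<le> clip f x"
  by (rule order_trans[OF lb_nonneg clip_bounds(1)])

lemma clip_le_U [simp]: "clip f x \<le> U"
  by (rule order_trans[OF clip_bounds(2) ub_le(1)])

lemma clip_le_exp: "clip f x \<le> exp (lam * x)"
  by (rule order_trans[OF clip_bounds(2) ub_le(2)])

lemma tau_nonneg [simp]: "0 \<le> u \<Longrightarrow> 0 \<le> \<tau> u" using tau_0 tau_ge[of u] by linarith

lemma tau_le: "0 \<le> u \<Longrightarrow> \<tau> u \<le> \<tau> 0 + u" using tau_lipschitz[of u 0] by simp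

lemma tau_cont: "continuous_on {0..} \<tau>"
  unfolding continuous_on_iff
proof (intro ballI allI impI)
  fix x e :: real assume "x \<in> {0..}" "0 < e"
  then show "\<exists>d>0. \<forall>y\<in>{0..}. dist y x < d \<longrightarrow> dist (\<tau> y) (\<tau> x) < e"
    using tau_lipschitz[of _ x] by (intro exI[of _ e]) (auto simp: dist_real_def intro: le_less_trans)
qed

lemma delayed_bounds: "0 \<le> delayed e f x" "delayed e f x \<le> d * U"
  unfolding delayed_def by (auto intro: b_nonneg b_le)

lemma exp_char: "lam\<^sup>2 * exp (lam * x) - c * lam * exp (lam * x) - d * exp (lam * x)
      + \<beta> * exp (lam * (x - c * \<tau> 0)) = 0"
proof -
  have "exp (lam * (x - c * \<tau> 0)) = exp (lam * x) * exp (- lam * c * \<tau> 0)"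
    by (simp add: exp_add[symmetric] algebra_simps)
  then have "lam\<^sup>2 * exp (lam * x) - c * lam * exp (lam * x) - d * exp (lam * x)
      + \<beta> * exp (lam * (x - c * \<tau> 0)) = exp (lam * x) * char_fun d \<beta> (\<tau> 0) lam c"
    by (simp add: char_fun_def algebra_simps)
  then show ?thesis by (simp add: char_lam)
qed

text \<open>The extra delay and \<open>\<tau> 0 \<le> \<tau> u\<close> both push the evaluation
  point to the left, where the increasing exponential is smaller. The bound
  \<open>b u \<le> \<beta> * u\<close> is linear, so only the barrier and not b has to be
  monotone.\<close>

lemma delayed_upper:
  assumes "e \<ge> 0"
  shows "delayed e f x \<le> \<beta> * exp (lam * (x - c * \<tau> 0))"
proof -
  define y where "y = x - e - c * \<tau> (clip f (x - e))"
  have "c * \<tau> 0 \<le> c * \<tau> (clip f (x - e))"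
    using c_pos by (intro mult_left_mono tau_ge) auto
  then have "y \<le> x - c * \<tau> 0" using assms by (simp add: y_def)
  then have "clip f y \<le> exp (lam * (x - c * \<tau> 0))"
    using clip_le_exp[of f y] lam_pos by (smt (verit) exp_le_cancel_iff mult_left_mono)
  then have "\<beta> * clip f y \<le> \<beta> * exp (lam * (x - c * \<tau> 0))"
    using beta_nonneg by (rule mult_left_mono)
  moreover have "b (clip f y) \<le> \<beta> * clip f y" by (rule b_le_linear) auto
  ultimately show ?thesis by (simp add: delayed_def y_def)
qed

text \<open>Since $\tau(u) \le \tau(0) + u$ and $u \le e^{\lambda x}$, replacing the delay by the constant
  \<open>\<tau> 0\<close> costs only a term of order $e^{2\lambda x}$.\<close>

lemma delayed_lower:
  assumes "e \<ge> 0" and e: "e \<le> exp (lam * x)" and x: "0 < lb0 x"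
  shows "\<beta> * (exp (lam * (x - c * \<tau> 0)) - q * exp (nu * (x - c * \<tau> 0)))
     - (\<beta> * lam * (1 + c) + L) * (exp (lam * x) * exp (lam * x)) \<le> delayed e f x"
proof -
  define E where "E = exp (lam * x)"
  define v where "v = clip f (x - e)"
  define y where "y = x - e - c * \<tau> v"
  define z where "z = x - c * \<tau> 0"
  define u where "u = clip f y"
  have E: "E > 0" by (simp add: E_def)
  have xK: "x \<le> 0" "E \<le> K" using q_dom[of x] x by (auto simp: lb0_def E_def)
  have zx: "z \<le> x" using c_pos tau_0 by (simp add: z_def)
  have "v \<le> exp (lam * (x - e))" by (simp add: v_def clip_le_exp)
  also have "\<dots> \<le> E" using assms(1) lam_pos by (simp add: E_def)
  finally have v: "0 \<le> v" "v \<le> E" by (auto simp: v_def)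
  have "c * \<tau> 0 \<le> c * \<tau> v" using c_pos v by (intro mult_left_mono tau_ge) auto
  then have yz: "y \<le> z" using assms(1) by (simp add: y_def z_def)
  have "c * \<tau> v \<le> c * (\<tau> 0 + E)" using c_pos v tau_le[of v] by (intro mult_left_mono) auto
  \<comment> \<open>The extra delay contributes at most E, the excess of \<tau> over
    \<open>\<tau> 0\<close> at most c E.\<close>
  then have zy: "z - y \<le> (1 + c) * E" using e by (simp add: y_def z_def E_def algebra_simps)
  have ez: "exp (lam * z) \<le> E" using zx lam_pos by (simp add: E_def)
  have uE: "u \<le> E"
    using clip_le_exp[of f y] yz ez lam_pos unfolding u_def
    by (smt (verit) exp_le_cancel_iff mult_left_mono)
  have u0: "0 \<le> u" by (simp add: u_def)
  have "exp (lam * z) * (1 - lam * ((1 + c) * E)) \<le> exp (lam * z) * exp (lam * (y - z))"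
  proof (rule mult_left_mono)
    have "lam * (z - y) \<le> lam * ((1 + c) * E)" using zy lam_pos by simp
    moreover have "1 + lam * (y - z) \<le> exp (lam * (y - z))" by (rule exp_ge_add_one_self)
    ultimately show "1 - lam * ((1 + c) * E) \<le> exp (lam * (y - z))" by (simp add: algebra_simps)
  qed simp
  also have "exp (lam * z) * exp (lam * (y - z)) = exp (lam * y)"
    by (simp add: exp_add[symmetric] algebra_simps)
  finally have 1: "exp (lam * z) - lam * (1 + c) * (exp (lam * z) * E) \<le> exp (lam * y)"
    by (simp add: algebra_simps)
  have "lam * (1 + c) * (exp (lam * z) * E) \<le> lam * (1 + c) * (E * E)"
    using ez E lam_pos c_pos by (intro mult_left_mono mult_right_mono) auto
  \<comment> \<open>For the negative part of the barrier the shift to the left has the favourable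
    sign.\<close>
  moreover have "q * exp (nu * y) \<le> q * exp (nu * z)"
    using yz q_pos lam_pos lam_less_nu by simp
  moreover have "exp (lam * y) - q * exp (nu * y) \<le> u"
    using clip_bounds(1)[of y f] by (simp add: u_def lb_def lb0_def)
  ultimately have "exp (lam * z) - q * exp (nu * z) - lam * (1 + c) * (E * E) \<le> u"
    using 1 by linarith
  then have "\<beta> * (exp (lam * z) - q * exp (nu * z) - lam * (1 + c) * (E * E)) \<le> \<beta> * u"
    using beta_nonneg by (rule mult_left_mono)
  moreover have "L * u\<^sup>2 \<le> L * (E * E)"
    using u0 uE L_nonneg unfolding power2_eq_square by (intro mult_left_mono mult_mono) auto
  moreover have "\<beta> * u - L * u\<^sup>2 \<le> b u"
    using u0 uE xK by (intro b_ge_quadratic) auto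
  ultimately have "\<beta> * (exp (lam * z) - q * exp (nu * z) - lam * (1 + c) * (E * E)) - L * (E * E)
      \<le> b u" by linarith
  moreover have "delayed e f x = b u" by (simp add: delayed_def u_def y_def v_def)
  ultimately show ?thesis by (simp add: z_def E_def algebra_simps)
qed

text \<open>The terms in \<open>exp (lam * x)\<close> cancel since lam is a root. The terms in
  \<open>exp (nu * x)\<close> leave a surplus of
  \<open>q * (- char_fun d \<beta> (\<tau> 0) nu c)\<close>, which by \<open>q_large\<close>
  dominates the errors in \<open>exp (2 * lam * x)\<close> for \<open>x \<le> 0\<close>.\<close>

lemma lb0_subsolution:
  assumes "e \<ge> 0" "e \<le> exp (lam * x)" "0 < lb0 x"
  shows "0 \<le> (lam\<^sup>2 * exp (lam * x) - q * (nu\<^sup>2 * exp (nu * x)))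
     - c * (lam * exp (lam * x) - q * (nu * exp (nu * x))) - d * lb0 x + delayed e f x"
proof -
  define C where "C = \<beta> * lam * (1 + c) + L"
  have C: "C \<ge> 0" using beta_nonneg lam_pos c_pos L_nonneg by (simp add: C_def)
  have x0: "x \<le> 0" using q_dom assms(3) by (auto simp: lb0_def)
  have "exp (lam * x) * exp (lam * x) \<le> exp (nu * x)"
  proof -
    have "(2 * lam) * x \<le> nu * x" using x0 nu_less by (intro mult_right_mono_neg) auto
    then show ?thesis by (simp add: exp_add[symmetric] algebra_simps)
  qed
  then have "C * (exp (lam * x) * exp (lam * x)) \<le> (q * (- char_fun d \<beta> (\<tau> 0) nu c)) * exp (nu * x)"
    using q_large C by (intro mult_mono) (auto simp: C_def)
  moreover have "exp (nu * (x - c * \<tau> 0)) = exp (nu * x) * exp (- nu * c * \<tau> 0)"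
    by (simp add: exp_add[symmetric] algebra_simps)
  then have "(q * (- char_fun d \<beta> (\<tau> 0) nu c)) * exp (nu * x) =
     - q * (nu\<^sup>2 * exp (nu * x)) + q * c * (nu * exp (nu * x)) + q * d * exp (nu * x)
     - q * \<beta> * exp (nu * (x - c * \<tau> 0))"
    by (simp add: char_fun_def algebra_simps)
  moreover note delayed_lower[OF assms, of f] exp_char[of x]
  ultimately show ?thesis unfolding C_def lb0_def by (simp add: algebra_simps)
qed

text \<open>F is arbitrary because the clipped forcing obeys the barrier inequalities for every
  function; this avoids circularity when F is later taken to be f. The bounds by 0, U,
  \<open>exp (lam * x)\<close> and \<open>lb0\<close> are four uses of the maximum principle.
  Nonnegativity comes first: wherever \<open>f < lb0\<close>, it shows that \<open>lb0\<close> is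
  positive, so that \<open>lb0_subsolution\<close> applies.\<close>

lemma comparison:
  assumes R: "0 \<le> R" and e: "e \<ge> 0" "e \<le> exp (- lam * R)"
    and cont: "continuous_on {-R..R} f" and ends: "f (-R) = ub (-R)" "f R = ub R"
    and f: "\<And>x. -R < x \<Longrightarrow> x < R \<Longrightarrow> (f has_real_derivative f' x) (at x)"
    and f': "\<And>x. -R < x \<Longrightarrow> x < R \<Longrightarrow>
       (f' has_real_derivative c * f' x + d * f x - delayed e F x) (at x)"
    and x: "-R \<le> x" "x \<le> R"
  shows "lb x \<le> f x" "f x \<le> ub x"
proof -
  note nonneg = nonneg_by_maximum_principle[where a = "-R" and e = R and d = d and c = c and x = x]
  have ub: "0 \<le> ub y" "lb0 y \<le> ub y" for y
    using lb_nonneg[of y] lb_le_ub[of y] by (auto simp: lb_def)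
  have f_nonneg: "0 \<le> f y" if y: "-R \<le> y" "y \<le> R" for y
  proof (rule nonneg_by_maximum_principle[where a = "-R" and e = R and d = d and c = c and x = y])
    show "c * f' y + d * f y - delayed e F y - c * f' y - d * f y \<le> 0" for y
      using delayed_bounds(1)[of e F y] by simp
  qed (use cont ends ub R d_pos y in \<open>auto intro: f f'\<close>)
  have 0: "0 \<le> f x" using f_nonneg x .
  have "0 \<le> U - f x"
  proof (rule nonneg)
    show "((\<lambda>x. U - f x) has_real_derivative - f' y) (at y)" if "-R < y" "y < R" for y
      using f[OF that] by (auto intro!: derivative_eq_intros)
    show "((\<lambda>x. - f' x) has_real_derivative - (c * f' y + d * f y - delayed e F y)) (at y)"
      if "-R < y" "y < R" for y
      by (rule DERIV_minus[OF f'[OF that]])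
    show "- (c * f' y + d * f y - delayed e F y) - c * (- f' y) - d * (U - f y) \<le> 0" for y
      using delayed_bounds(2)[of e F y] by (simp add: algebra_simps)
  qed (use R ends cont ub_le d_pos x in \<open>auto intro!: continuous_intros\<close>)
  moreover have "0 \<le> exp (lam * x) - f x"
  proof (rule nonneg)
    show "((\<lambda>x. exp (lam * x) - f x) has_real_derivative lam * exp (lam * y) - f' y) (at y)"
      if "-R < y" "y < R" for y
      using f[OF that] by (auto intro!: derivative_eq_intros)
    show "((\<lambda>x. lam * exp (lam * x) - f' x) has_real_derivative
        lam\<^sup>2 * exp (lam * y) - (c * f' y + d * f y - delayed e F y)) (at y)"
      if "-R < y" "y < R" for y
      using f'[OF that] by (auto intro!: derivative_eq_intros simp: power2_eq_square)
    show "lam\<^sup>2 * exp (lam * y) - (c * f' y + d * f y - delayed e F y)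
        - c * (lam * exp (lam * y) - f' y) - d * (exp (lam * y) - f y) \<le> 0" for y
      using delayed_upper[OF e(1), of F y] exp_char[of y] by (simp add: algebra_simps)
  qed (use R ends cont d_pos x ub_le(2)[of "-R"] ub_le(2)[of R] in \<open>auto intro!: continuous_intros\<close>)
  ultimately show "f x \<le> ub x" by (simp add: ub_def)
  have "0 \<le> f x - lb0 x"
  proof (rule nonneg)
    show "((\<lambda>x. f x - lb0 x) has_real_derivative
        f' y - (lam * exp (lam * y) - q * (nu * exp (nu * y)))) (at y)"
      if "-R < y" "y < R" for y
      unfolding lb0_def using f[OF that] by (auto intro!: derivative_eq_intros)
    show "((\<lambda>y. f' y - (lam * exp (lam * y) - q * (nu * exp (nu * y)))) has_real_derivative
        c * f' y + d * f y - delayed e F y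
         - (lam\<^sup>2 * exp (lam * y) - q * (nu\<^sup>2 * exp (nu * y)))) (at y)"
      if "-R < y" "y < R" for y
      using f'[OF that] by (auto intro!: derivative_eq_intros simp: power2_eq_square)
    show "c * f' y + d * f y - delayed e F y
         - (lam\<^sup>2 * exp (lam * y) - q * (nu\<^sup>2 * exp (nu * y)))
         - c * (f' y - (lam * exp (lam * y) - q * (nu * exp (nu * y)))) - d * (f y - lb0 y) \<le> 0"
      if y: "-R < y" "y < R" and neg: "f y - lb0 y < 0" for y
    proof -
      \<comment> \<open>The smallest value of the exponential on the interval: this is where the
        bound on e comes from.\<close>
      have "exp (- lam * R) \<le> exp (lam * y)"
        using y(1) lam_pos mult_left_mono[of "-R" y lam] by simp
      with e have "e \<le> exp (lam * y)" by linarith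
      moreover have "0 < lb0 y" using f_nonneg[of y] y neg by simp
      ultimately show ?thesis
        using lb0_subsolution[of e y F] e(1) by (simp add: algebra_simps)
    qed
  qed (use R ends cont d_pos x ub(2)[of "-R"] ub(2)[of R] in
      \<open>auto intro!: continuous_intros simp: lb0_def\<close>)
  with 0 show "lb x \<le> f x" by (simp add: lb_def)
qed

section \<open>Solving the clipped problem on a bounded interval\<close>

lemma ub_cont: "continuous_on S ub"
  unfolding ub_def by (intro continuous_intros)

lemma lb_cont: "continuous_on S lb"
  unfolding lb_def lb0_def by (intro continuous_intros)

lemma continuous_on_delayed:
  assumes "continuous_on UNIV (\<lambda>z. F (fst z) (snd z))"
  shows "continuous_on UNIV (\<lambda>z. delayed e (F (fst z)) (snd z))"
proof -
  define G where "G = (\<lambda>z. clip (F (fst z)) (snd z))"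
  have G: "continuous_on UNIV G"
    unfolding G_def clip_def
    by (intro continuous_intros assms continuous_on_compose2[OF ub_cont[of UNIV]]
        continuous_on_compose2[OF lb_cont[of UNIV]]) auto
  have "continuous_on UNIV (\<lambda>z. G (fst z, snd z - e))"
    by (intro continuous_on_compose2[OF G] continuous_intros) auto
  then have "continuous_on UNIV (\<lambda>z. \<tau> (G (fst z, snd z - e)))"
    by (rule continuous_on_compose2[OF tau_cont]) (auto simp: G_def)
  then have "continuous_on UNIV (\<lambda>z. G (fst z, snd z - e - c * \<tau> (G (fst z, snd z - e))))"
    by (intro continuous_on_compose2[OF G] continuous_intros) auto
  then have "continuous_on UNIV (\<lambda>z. b (G (fst z, snd z - e - c * \<tau> (G (fst z, snd z - e)))))"
    by (rule continuous_on_compose2[OF b_cont]) (auto simp: G_def)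
  then show ?thesis by (simp add: delayed_def G_def)
qed

text \<open>The method of steps: the \<open>n\<close>-th iterate solves the delayed equation up to $a + n e$.\<close>

primrec steps :: "real \<Rightarrow> real \<Rightarrow> nat \<Rightarrow> real \<Rightarrow> real \<Rightarrow> real" where
  "steps a e 0 p x = ub (min a x)"
| "steps a e (Suc n) p x = ub (min a x) - ub a
     + shot a (ub a) p (delayed e (steps a e n p)) (max a x)"

text \<open>In \<open>steps\<close> the history and the shot are glued without a case distinction:
  right of a the two \<open>ub\<close> terms cancel, left of a the shot equals \<open>ub a\<close>.
  Continuity in slope and position thus follows by composition.\<close>

lemma steps_cont: "continuous_on UNIV (\<lambda>z. steps a e n (fst z) (snd z))"
proof (induction n)
  case 0
  then show ?case
    by (auto intro!: continuous_on_compose2[OF ub_cont[of UNIV]] continuous_intros)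
next
  case (Suc n)
  then show ?case
    by (auto intro!: continuous_on_compose2[OF ub_cont[of UNIV]] continuous_intros
        continuous_on_shot continuous_on_delayed)
qed

lemma steps_history: "x \<le> a \<Longrightarrow> steps a e n p x = ub x"
  by (cases n) (auto simp: min_absorb2 max_absorb1)

text \<open>The forcing at s reads an iterate only up to \<open>s - e\<close>, so agreement of
  iterates up to one point yields agreement of the next ones up to e further.\<close>

lemma steps_stable:
  assumes "e \<ge> 0" "x \<le> a + n * e"
  shows "steps a e (Suc n) p x = steps a e n p x"
  using assms(2)
proof (induction n arbitrary: x)
  case 0
  then show ?case using steps_history[of x a] by (simp del: steps.simps)
next
  case (Suc n)
  show ?case
  proof (cases "x \<le> a")
    case False
    have "delayed e (steps a e (Suc n) p) s = delayed e (steps a e n p) s" if s: "s \<le> x" for s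
    proof -
      have IH: "clip (steps a e (Suc n) p) y = clip (steps a e n p) y" if "y \<le> s - e" for y
        using Suc that s by (simp add: clip_def algebra_simps del: steps.simps)
      show ?thesis
        unfolding delayed_def using c_pos by (subst IH, simp)+ simp
    qed
    then have "shot a (ub a) p (delayed e (steps a e (Suc n) p)) x =
        shot a (ub a) p (delayed e (steps a e n p)) x"
      by (intro shot_cong) auto
    then show ?thesis using False
      by (subst (1 2) steps.simps(2)) (simp del: steps.simps)
  qed (simp add: steps_history del: steps.simps)
qed

lemma approximate_solution:
  assumes R: "0 < R" and e: "e > 0" "e \<le> exp (- lam * R)"
  obtains f f' where "\<And>x. x \<le> R \<Longrightarrow> lb x \<le> f x \<and> f x \<le> ub x"
    "continuous_on UNIV f"
    "\<And>x. -R < x \<Longrightarrow> x < R \<Longrightarrow> (f has_real_derivative f' x) (at x)"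
    "\<And>x. -R < x \<Longrightarrow> x < R \<Longrightarrow> (f' has_real_derivative
        c * f' x + d * f x - b (f (x - e - c * \<tau> (f (x - e))))) (at x)"
proof -
  define a where "a = - R"
  \<comment> \<open>Then \<open>a + n * e\<close> exceeds R, so on [-R, R] the iterates n and n + 1
    coincide.\<close>
  obtain n :: nat where n: "2 * R < n * e" using reals_Archimedean3[OF e(1)] by blast
  define g where "g p = delayed e (steps a e n p)" for p
  have g_cont2: "continuous_on UNIV (\<lambda>z. g (fst z) (snd z))"
    unfolding g_def by (intro continuous_on_delayed steps_cont)
  have g_cont: "continuous_on UNIV (g p)" for p
  proof -
    have "continuous_on UNIV (\<lambda>x. g (fst (p, x)) (snd (p, x)))"
      by (rule continuous_on_compose2[OF g_cont2 continuous_on_Pair[OF continuous_on_const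
            continuous_on_id]]) simp
    then show ?thesis by simp
  qed
  have aR: "a < R" using R by (simp add: a_def)
  have "continuous_on UNIV (\<lambda>p. shot a (ub a) p (g p) (max a R))"
  proof -
    have "continuous_on UNIV (\<lambda>p::real. (p, R))" by (intro continuous_intros)
    from continuous_on_compose2[OF continuous_on_shot[OF g_cont2] this]
    show ?thesis by simp
  qed
  then have "continuous_on UNIV (\<lambda>p. shot a (ub a) p (g p) R)"
    using aR by simp
  then obtain p where p: "shot a (ub a) p (g p) R = ub R"
    by (rule shot_hits[where g = g and B = "d * U"])
      (use aR g_cont delayed_bounds in \<open>auto simp: g_def\<close>)
  define f where "f = steps a e (Suc n) p"
  define f' where "f' = shot' a (ub a) p (g p)"
  have f_eq: "f x = shot a (ub a) p (g p) x" if "a \<le> x" for x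
    using that by (simp add: f_def g_def)
  have f_cont: "continuous_on UNIV f"
  proof -
    have "continuous_on UNIV (\<lambda>x. steps a e (Suc n) (fst (p, x)) (snd (p, x)))"
      by (rule continuous_on_compose2[OF steps_cont[of a e "Suc n"]
            continuous_on_Pair[OF continuous_on_const continuous_on_id]]) simp
    then show ?thesis by (simp add: f_def del: steps.simps)
  qed
  \<comment> \<open>The forcing was built from iterate n while f is iterate n + 1; their agreement
    turns f into a solution with its own delayed forcing.\<close>
  have g_eq: "g p x = delayed e f x" if "x \<le> R" for x
  proof -
    have "clip f y = clip (steps a e n p) y" if "y \<le> x - e" for y
      unfolding clip_def f_def using that \<open>x \<le> R\<close> n e
      by (subst steps_stable) (auto simp: a_def simp del: steps.simps)
    moreover have "x - e - c * \<tau> (clip f' (x - e)) \<le> x - e" for f'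
      using c_pos by simp
    ultimately show ?thesis unfolding g_def delayed_def by simp
  qed
  have df: "(f has_real_derivative f' x) (at x)" if "a < x" for x
  proof (rule has_field_derivative_transform_within_open[of _ _ _ "{a<..}"])
    show "(shot a (ub a) p (g p) has_real_derivative f' x) (at x)"
      unfolding f'_def by (rule shot_DERIV[OF g_cont that])
  qed (use that f_eq in auto)
  have df': "(f' has_real_derivative c * f' x + d * f x - delayed e f x) (at x)"
    if "a < x" "x < R" for x
    using shot'_DERIV[OF g_cont that(1), of "ub a" p p] that f_eq[of x] g_eq[of x]
    unfolding f'_def by simp
  have bounds: "lb x \<le> f x \<and> f x \<le> ub x" if "x \<le> R" for x
  proof (cases "x \<le> a")
    case True
    then have "f x = ub x" unfolding f_def by (rule steps_history)
    then show ?thesis using lb_le_ub[of x] by simp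
  next
    case False
    have "f (-R) = ub (-R)" using f_eq[of a] by (simp add: a_def)
    moreover have "f R = ub R" using f_eq[of R] aR p by simp
    ultimately show ?thesis
      using comparison[of R e f f' f x] R e f_cont df df' that False
      by (auto simp: a_def intro: continuous_on_subset)
  qed
  have "delayed e f x = b (f (x - e - c * \<tau> (f (x - e))))" if "x < R" for x
  proof -
    have clip: "clip f y = f y" if "y \<le> R" for y using bounds[OF that] by (simp add: clip_eq)
    have "clip f (x - e) = f (x - e)" using that e by (intro clip) simp
    moreover have "c * \<tau> (clip f (x - e)) \<ge> 0" using c_pos by simp
    then have "clip f (x - e - c * \<tau> (clip f (x - e))) = f (x - e - c * \<tau> (clip f (x - e)))"
      using that e by (intro clip) linarith
    ultimately show ?thesis by (simp add: delayed_def)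
  qed
  then show ?thesis
    using that[of f f'] bounds f_cont df df' by (simp add: a_def)
qed

end

section \<open>The wave\<close>

context wave
begin

lemma entire_solution:
  obtains f f' where "\<And>x. lb x \<le> f x \<and> f x \<le> ub x"
    "\<And>x. (f has_real_derivative f' x) (at x)"
    "\<And>x. (f' has_real_derivative c * f' x + d * f x - b (f (x - c * \<tau> (f x)))) (at x)"
proof -
  define R where "R n = real n + 2" for n
  define e where "e n = exp (- lam * R n)" for n
  have "\<exists>f f'. (\<forall>x\<le>R n. lb x \<le> f x \<and> f x \<le> ub x) \<and> continuous_on UNIV f \<and>
    (\<forall>x. -R n < x \<and> x < R n \<longrightarrow> (f has_real_derivative f' x) (at x) \<and>
      (f' has_real_derivative
        c * f' x + d * f x - b (f (x - e n - c * \<tau> (f (x - e n))))) (at x))" for n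
  proof -
    have "0 < R n" "0 < e n" "e n \<le> exp (- lam * R n)" by (auto simp: R_def e_def)
    then show ?thesis by (rule approximate_solution) blast
  qed
  then obtain f f' where
    ff: "\<And>n. (\<forall>x\<le>R n. lb x \<le> f n x \<and> f n x \<le> ub x) \<and> continuous_on UNIV (f n) \<and>
    (\<forall>x. -R n < x \<and> x < R n \<longrightarrow> (f n has_real_derivative f' n x) (at x) \<and>
      (f' n has_real_derivative
        c * f' n x + d * f n x - b (f n (x - e n - c * \<tau> (f n (x - e n))))) (at x))"
    by metis
  have e: "0 \<le> e n" "e n \<le> 1" for n
    using lam_pos by (auto simp: e_def R_def)
  have f_range: "f n x \<in> {0..U}" if "x \<le> R n" for n x
    using ff[of n] that lb_nonneg[of x] ub_le(1)[of x] by (smt (verit) atLeastAtMost_iff)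
  define g where "g n x = d * f n x - b (f n (x - e n - c * \<tau> (f n (x - e n))))" for n x
  have g: "\<bar>g n x\<bar> \<le> d * U" if "x < R n" for n x
  proof -
    have 1: "f n (x - e n) \<in> {0..U}" using that e[of n] by (intro f_range) simp
    then have "0 \<le> c * \<tau> (f n (x - e n))" using c_pos by simp
    then have "f n (x - e n - c * \<tau> (f n (x - e n))) \<in> {0..U}"
      using that e[of n] by (intro f_range) linarith
    moreover have "f n x \<in> {0..U}" using that by (intro f_range) simp
    then have "0 \<le> d * f n x" "d * f n x \<le> d * U"
      using d_pos by auto
    ultimately show ?thesis
      using b_nonneg[of "f n (x - e n - c * \<tau> (f n (x - e n)))"]
        b_le[of "f n (x - e n - c * \<tau> (f n (x - e n)))"]
      unfolding g_def abs_le_iff by simp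
  qed
  have df: "(f n has_real_derivative f' n x) (at x)"
    "(f' n has_real_derivative c * f' n x + g n x) (at x)" if "-R n < x" "x < R n" for n x
    using ff[of n] that by (auto simp: g_def algebra_simps)
  define C1 where "C1 = exp c * (U + d * U)"
  define C2 where "C2 = c * C1 + d * U"
  have C1: "C1 \<ge> 0" and C2: "C2 \<ge> 0"
    using U_pos d_pos c_pos by (auto simp: C1_def C2_def)
  have f'_bound: "\<bar>f' n x\<bar> \<le> C1" if "-R n < x" "x < R n" for n x
    unfolding C1_def
  proof (rule slope_bound[where f = "f n" and f' = "f' n" and x = x and R = "R n" and g = "g n"])
    show "continuous_on {-R n..R n} (f n)"
      using ff[of n] by (auto elim: continuous_on_subset)
  qed (use c_pos that df g f_range in \<open>auto simp: R_def\<close>)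

  \<comment> \<open>Retracting onto [-(n + 1), n + 1], strictly inside the interval where the
    equation holds, gives globally bounded and Lipschitz functions without changing them on that
    set.\<close>
  define p where "p n x = max (- (real n + 1)) (min (real n + 1) x)" for n x
  have p: "- R n < p n x" "p n x < R n" "p n x \<in> {- (real n + 1)..real n + 1}" for n x
    by (auto simp: p_def R_def)
  have p_lip: "\<bar>p n x - p n y\<bar> \<le> \<bar>x - y\<bar>" for n x y by (auto simp: p_def)
  have p_eq: "p n x = x" if "\<bar>x\<bar> \<le> real n + 1" for n x using that by (auto simp: p_def)
  define F where "F n x = (f n (p n x), f' n (p n x))" for n x
  have f_lip: "\<bar>f n (p n x) - f n (p n y)\<bar> \<le> C1 * \<bar>x - y\<bar>" for n x y
  proof -
    have "\<bar>f n (p n x) - f n (p n y)\<bar> \<le> C1 * \<bar>p n x - p n y\<bar>"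
      by (rule lipschitz_by_DERIV[OF df(1) f'_bound p(3) p(3)]) (auto simp: R_def)
    also have "\<dots> \<le> C1 * \<bar>x - y\<bar>" using C1 by (intro mult_left_mono p_lip)
    finally show ?thesis .
  qed
  have f'_lip: "\<bar>f' n (p n x) - f' n (p n y)\<bar> \<le> C2 * \<bar>x - y\<bar>" for n x y
  proof -
    have "\<bar>c * f' n z + g n z\<bar> \<le> C2" if "-R n < z" "z < R n" for z
    proof -
      have "\<bar>c * f' n z\<bar> \<le> c * C1"
        unfolding abs_mult using c_pos f'_bound[OF that] by (intro mult_mono) auto
      then show ?thesis using g[of z n] that unfolding C2_def by linarith
    qed
    then have "\<bar>f' n (p n x) - f' n (p n y)\<bar> \<le> C2 * \<bar>p n x - p n y\<bar>"
      by (intro lipschitz_by_DERIV[OF df(2) _ p(3) p(3)]) (auto simp: R_def)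
    also have "\<dots> \<le> C2 * \<bar>x - y\<bar>" using C2 by (intro mult_left_mono p_lip)
    finally show ?thesis .
  qed
  obtain G k where k: "strict_mono (k :: nat \<Rightarrow> nat)"
    and lim: "\<And>r. uniform_limit {-r..r} (\<lambda>n. F (k n)) G sequentially"
  proof (rule lipschitz_sequence_compact[of F "U + C1" "C1 + C2"])
    show "norm (F n x) \<le> U + C1" for n x
      using norm_Pair_le[of "f n (p n x)" "f' n (p n x)"] f_range[of "p n x" n] f'_bound[OF p(1,2), of n x]
        p(2)[of n x] by (auto simp: F_def)
    show "norm (F n x - F n y) \<le> (C1 + C2) * \<bar>x - y\<bar>" for n x y
      using norm_Pair_le[of "f n (p n x) - f n (p n y)" "f' n (p n x) - f' n (p n y)"]
        f_lip[of n x y] f'_lip[of n x y] by (auto simp: F_def algebra_simps)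
  qed blast
  define v where "v = fst \<circ> G"
  define v' where "v' = snd \<circ> G"
  define u where "u n x = fst (F (k n) x)" for n x
  define u' where "u' n x = snd (F (k n) x)" for n x
  have lim_u: "uniform_limit {-r..r} u v sequentially" for r
    using bounded_linear.uniform_limit[OF bounded_linear_fst lim, of r]
    by (simp add: u_def[abs_def] v_def comp_def)
  have lim_u': "uniform_limit {-r..r} u' v' sequentially" for r
    using bounded_linear.uniform_limit[OF bounded_linear_snd lim, of r]
    by (simp add: u'_def[abs_def] v'_def comp_def)
  have lim_ux: "(\<lambda>n. u n x) \<longlonglongrightarrow> v x" for x
    by (rule tendsto_uniform_limitI[OF lim_u[of "\<bar>x\<bar>"]]) auto
  have u_range: "u n x \<in> {0..U}" for n x
    using f_range[of "p (k n) x" "k n"] p(2)[of "k n" x] by (simp add: u_def F_def)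
  have u_eq: "u n x = f (k n) x" "u' n x = f' (k n) x" if "\<bar>x\<bar> \<le> real n + 1" for n x
  proof -
    have "real n \<le> real (k n)" using seq_suble[OF k, of n] by simp
    then show "u n x = f (k n) x" "u' n x = f' (k n) x"
      using that by (simp_all add: u_def u'_def F_def p_eq)
  qed
  have ev_near: "\<forall>\<^sub>F n in sequentially. r \<le> real n" for r
    using filterlim_real_sequentially unfolding filterlim_at_top by blast
  have v_bounds: "lb x \<le> v x \<and> v x \<le> ub x" for x
  proof -
    have "\<forall>\<^sub>F n in sequentially. lb x \<le> u n x \<and> u n x \<le> ub x"
      using ev_near[of "\<bar>x\<bar>"]
    proof eventually_elim
      case (elim n)
      have "real n \<le> real (k n)" using seq_suble[OF k, of n] by simp
      then show ?case using ff[of "k n"] elim u_eq[of x n] by (auto simp: R_def)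
    qed
    then show ?thesis
      using tendsto_lowerbound[OF lim_ux] tendsto_upperbound[OF lim_ux]
      by (auto simp: eventually_conj_iff)
  qed
  have v_range: "v x \<in> {0..U}" for x
    using v_bounds[of x] lb_nonneg[of x] ub_le(1)[of x] by (simp del: lb_nonneg)
  have v_lip: "\<bar>v x - v y\<bar> \<le> C1 * \<bar>x - y\<bar>" for x y
  proof (rule tendsto_upperbound)
    show "(\<lambda>n. \<bar>u n x - u n y\<bar>) \<longlonglongrightarrow> \<bar>v x - v y\<bar>"
      by (intro tendsto_intros lim_ux)
    show "\<forall>\<^sub>F n in sequentially. \<bar>u n x - u n y\<bar> \<le> C1 * \<bar>x - y\<bar>"
      using f_lip by (simp add: u_def F_def)
  qed simp
  have "filterlim (\<lambda>n. real (k n)) at_top sequentially"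
    using filterlim_subseq[OF k] filterlim_real_sequentially by (rule filterlim_compose[rotated])
  then have "filterlim (\<lambda>n. real (k n) + 2) at_top sequentially"
    by (rule filterlim_tendsto_add_at_top[OF tendsto_const, of _ _ 2, simplified add.commute])
  then have "filterlim (\<lambda>n. - lam * (real (k n) + 2)) at_bot sequentially"
    using lam_pos by (intro filterlim_tendsto_neg_mult_at_bot[OF tendsto_const]) auto
  then have e_lim: "(\<lambda>n. e (k n)) \<longlonglongrightarrow> 0"
    unfolding e_def R_def by (rule filterlim_compose[OF exp_at_bot])
  have tau_range: "\<tau> x \<in> {0..\<tau> 0 + U}" if "x \<in> {0..U}" for x
    using that tau_le[of x] by simp
  have arg_lim: "uniform_limit {-r..r}
      (\<lambda>n x. u n (x - e (k n) - c * \<tau> (u n (x - e (k n))))) (\<lambda>x. v (x - c * \<tau> (v x))) sequentially" for r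
    by (rule uniform_limit_delayed_argument[where U = U and C = C1 and T = "\<tau> 0 + U"])
      (use lim_u v_lip e_lim e u_range v_range c_pos tau_range tau_lipschitz in auto)
  have b_uc: "uniformly_continuous_on {0..U} b"
    by (intro compact_uniformly_continuous b_cont) simp
  have b_lim: "uniform_limit {-r..r}
      (\<lambda>n x. b (u n (x - e (k n) - c * \<tau> (u n (x - e (k n))))))
      (\<lambda>x. b (v (x - c * \<tau> (v x)))) sequentially" for r
    by (rule uniform_limit_compose[OF arg_lim b_uc, unfolded comp_def])
      (use u_range v_range in \<open>auto intro!: always_eventually\<close>)
  have u''_lim: "uniform_limit {-r..r}
      (\<lambda>n x. c * u' n x + d * u n x - b (u n (x - e (k n) - c * \<tau> (u n (x - e (k n))))))
      (\<lambda>x. c * v' x + d * v x - b (v (x - c * \<tau> (v x)))) sequentially" for r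
    by (intro uniform_limit_minus uniform_limit_add lim_u lim_u' b_lim
        bounded_linear.uniform_limit[OF bounded_linear_mult_right])
  \<comment> \<open>For such n the point, its shift by e and the delayed argument all lie where the
    retraction is the identity, so \<open>u n\<close> inherits the equation.\<close>
  have der: "(u n has_real_derivative u' n x) (at x)"
    "(u' n has_real_derivative
      c * u' n x + d * u n x - b (u n (x - e (k n) - c * \<tau> (u n (x - e (k n)))))) (at x)"
    if n: "\<bar>x\<bar> + 1 + c * (\<tau> 0 + U) \<le> real n" for n x
  proof -
    have cT: "0 \<le> c * \<tau> (u n y)" "c * \<tau> (u n y) \<le> c * (\<tau> 0 + U)" for y
      using u_range[of n y] tau_le[of "u n y"] c_pos by (auto intro!: mult_left_mono)
    have "0 \<le> c * (\<tau> 0 + U)" using order_trans[OF cT] .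
    then have near: "\<bar>x\<bar> \<le> real n + 1" "\<bar>x - e (k n)\<bar> \<le> real n + 1"
      "\<bar>x - e (k n) - c * \<tau> (u n (x - e (k n)))\<bar> \<le> real n + 1" and x: "\<bar>x\<bar> < real n + 1"
      using n e[of "k n"] cT[of "x - e (k n)"] by linarith+
    have "real n \<le> real (k n)" using seq_suble[OF k, of n] by simp
    then have xR: "- R (k n) < x" "x < R (k n)" using x by (auto simp: R_def)
    have open_S: "open {-(real n + 1)<..<real n + 1}" "x \<in> {-(real n + 1)<..<real n + 1}"
      using x by auto
    have "f (k n) y = u n y" "f' (k n) y = u' n y" if "y \<in> {-(real n + 1)<..<real n + 1}" for y
      using u_eq[of y n] that by auto
    note transform = has_field_derivative_transform_within_open[OF _ open_S, of _ _ "u n"]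
      has_field_derivative_transform_within_open[OF _ open_S, of _ _ "u' n"]
    show "(u n has_real_derivative u' n x) (at x)"
      using df(1)[OF xR] u_eq[of x n] near(1) u_eq(1)[of _ n]
      by (intro transform(1)[of "f (k n)"]) auto
    have "(u' n has_real_derivative c * f' (k n) x + g (k n) x) (at x)"
      using df(2)[OF xR] u_eq(2)[of _ n]
      by (intro transform(2)[of "f' (k n)"]) auto
    moreover have "c * f' (k n) x + g (k n) x
       = c * u' n x + d * u n x - b (u n (x - e (k n) - c * \<tau> (u n (x - e (k n)))))"
      using near by (simp add: g_def u_eq)
    ultimately show "(u' n has_real_derivative
      c * u' n x + d * u n x - b (u n (x - e (k n) - c * \<tau> (u n (x - e (k n)))))) (at x)"
      by simp
  qed
  have ev_der: "\<forall>\<^sub>F n in sequentially. \<forall>x\<in>{-r..r}. \<bar>x\<bar> + 1 + c * (\<tau> 0 + U) \<le> real n" for r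
    using ev_near[of "r + 1 + c * (\<tau> 0 + U)"] by eventually_elim auto
  have "(v has_real_derivative v' x) (at x)" for x
  proof (rule uniform_limit_DERIV[where r = "\<bar>x\<bar> + 1", OF _ lim_u lim_u'])
    show "\<forall>\<^sub>F n in sequentially. \<forall>y\<in>{- (\<bar>x\<bar> + 1)..\<bar>x\<bar> + 1}.
        (u n has_real_derivative u' n y) (at y)"
      using ev_der by (rule eventually_mono) (use der(1) in blast)
  qed simp
  moreover have "(v' has_real_derivative c * v' x + d * v x - b (v (x - c * \<tau> (v x)))) (at x)" for x
  proof (rule uniform_limit_DERIV[where r = "\<bar>x\<bar> + 1", OF _ lim_u' u''_lim])
    show "\<forall>\<^sub>F n in sequentially. \<forall>y\<in>{- (\<bar>x\<bar> + 1)..\<bar>x\<bar> + 1}. (u' n has_real_derivative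
      c * u' n y + d * u n y - b (u n (y - e (k n) - c * \<tau> (u n (y - e (k n)))))) (at y)"
      using ev_der by (rule eventually_mono) (use der(2) in blast)
  qed simp
  ultimately show ?thesis using that v_bounds by blast
qed

text \<open>\<open>- ln q / (nu - lam)\<close> is the zero of \<open>lb0\<close>. Positivity
  arbitrarily far to the left is what excludes the trivial solution.\<close>

lemma lb0_pos_below: "\<exists>x\<le>y. 0 < lb0 x"
proof (intro exI[of _ "min y (- ln q / (nu - lam) - 1)"] conjI)
  define x where "x = min y (- ln q / (nu - lam) - 1)"
  have "x < - ln q / (nu - lam)" by (simp add: x_def min_less_iff_disj)
  then have "(nu - lam) * x < - ln q" using lam_less_nu by (simp add: field_simps)
  then have "exp (ln q + nu * x) < exp (lam * x)" by (simp add: algebra_simps)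
  then show "0 < lb0 x" using q_pos by (simp add: lb0_def exp_add)
qed simp

lemma travelling_wave:
  assumes "\<epsilon> > 0"
    and b_persist: "\<And>u v. 0 < u \<Longrightarrow> u < \<epsilon> \<Longrightarrow> u \<le> v \<Longrightarrow> v \<le> U \<Longrightarrow> d * u < b v"
  obtains f f' f'' where "C2_real f f' f''" "\<And>x. f x > 0"
    "\<And>x. f'' x - c * f' x - d * f x + b (f (x - c * \<tau> (f x))) = 0"
    "(f \<longlongrightarrow> 0) at_bot" "Liminf at_top (\<lambda>x. ereal (f x)) > 0"
proof -
  obtain f f' where bounds: "\<And>x. lb x \<le> f x \<and> f x \<le> ub x"
    and f: "\<And>x. (f has_real_derivative f' x) (at x)"
    and f': "\<And>x. (f' has_real_derivative c * f' x + d * f x - b (f (x - c * \<tau> (f x)))) (at x)"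
    using entire_solution by blast
  define f'' where "f'' x = c * f' x + d * f x - b (f (x - c * \<tau> (f x)))" for x
  have range: "f x \<in> {0..U}" for x
    using bounds[of x] lb_nonneg[of x] ub_le(1)[of x] by (simp del: lb_nonneg)
  have pos: "f x > 0" for x
  proof (rule supersolution_positive[OF f f'])
    fix x
    show "c * f' x + d * f x - b (f (x - c * \<tau> (f x))) - c * f' x - d * f x \<le> 0"
      using range[of "x - c * \<tau> (f x)"] b_nonneg by simp
    show "f x \<ge> 0" using range[of x] by simp
    show "\<exists>z\<le>x. f z > 0"
      using lb0_pos_below[of x] bounds unfolding lb_def by (smt (verit))
  qed
  have delay: "0 \<le> c * \<tau> (f x) \<and> c * \<tau> (f x) \<le> c * (\<tau> 0 + U)" for x
    using range[of x] tau_le[of "f x"] c_pos by (auto intro!: mult_left_mono)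
  obtain \<delta> where \<delta>: "\<delta> > 0" "\<And>x. 0 \<le> x \<Longrightarrow> \<delta> \<le> f x"
  proof (rule delayed_equation_persistence[OF f f' pos _ c_pos delay \<open>\<epsilon> > 0\<close> b_persist])
    show "f x \<le> U" for x using range[of x] by simp
  qed blast+
  have f_cont: "continuous_on UNIV f" and f'_cont: "continuous_on UNIV f'"
    using f f' by (auto intro!: continuous_at_imp_continuous_on DERIV_isCont)
  have "continuous_on UNIV (\<lambda>x. \<tau> (f x))"
    using range by (intro continuous_on_compose2[OF tau_cont f_cont]) auto
  then have "continuous_on UNIV (\<lambda>x. f (x - c * \<tau> (f x)))"
    by (intro continuous_on_compose2[OF f_cont] continuous_intros) auto
  then have "continuous_on UNIV (\<lambda>x. b (f (x - c * \<tau> (f x))))"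
    using range by (intro continuous_on_compose2[OF b_cont]) auto
  then have "continuous_on UNIV f''"
    unfolding f''_def by (intro continuous_intros f_cont f'_cont)
  then have "C2_real f f' f''"
    using f f' by (simp add: C2_real_def f''_def)
  moreover have "f'' x - c * f' x - d * f x + b (f (x - c * \<tau> (f x))) = 0" for x
    by (simp add: f''_def)
  moreover have "(f \<longlongrightarrow> 0) at_bot"
  proof (rule tendsto_sandwich[of "\<lambda>_. 0"])
    have "filterlim (\<lambda>x. lam * x) at_bot at_bot"
      using lam_pos by (intro filterlim_tendsto_pos_mult_at_bot[OF tendsto_const]) (auto simp: filterlim_ident)
    then show "((\<lambda>x. exp (lam * x)) \<longlongrightarrow> 0) at_bot"
      by (rule filterlim_compose[OF exp_at_bot])
    show "\<forall>\<^sub>F x in at_bot. f x \<le> exp (lam * x)"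
      using bounds ub_le(2) order_trans by (intro always_eventually) blast
  qed (use pos in \<open>auto intro!: always_eventually less_imp_le\<close>)
  moreover have "Liminf at_top (\<lambda>x. ereal (f x)) > 0"
  proof -
    have "ereal \<delta> \<le> Liminf at_top (\<lambda>x. ereal (f x))"
      using \<delta>(2) by (intro Liminf_bounded) (auto intro: eventually_mono[OF eventually_ge_at_top[of 0]])
    moreover have "0 < ereal \<delta>" using \<delta>(1) by simp
    ultimately show ?thesis by (rule less_le_trans[rotated])
  qed
  ultimately show ?thesis using that pos by blast
qed

end

section \<open>Choice of the constants and conclusion\<close>

theorem theorem3p3:
  fixes d K M L c :: real
    and b b' \<tau> \<tau>' :: "real \<Rightarrow> real"
  assumes "d > 0" and "K > 0"
    and b_nonneg: "\<forall>u\<ge>0. b u \<ge> 0"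
    and b_zero: "b 0 = 0"
    and b_K: "b K = d * K"
    and b_below_K: "\<forall>u. 0 < u \<and> u < K \<longrightarrow> b u > d * u"
    and b_above_K: "\<forall>u>K. 0 < b u \<and> b u < d * u"
    and tau_nonneg: "\<forall>u\<ge>0. \<tau> u \<ge> 0"
    and tau_C1: "C1_halfline \<tau> \<tau>'"
    and tau_deriv: "\<forall>u\<ge>0. 0 \<le> \<tau>' u \<and> \<tau>' u < 1"
    and tau_lim: "(\<tau> \<longlongrightarrow> M) at_top"
    and tau_0: "0 \<le> \<tau> 0" "\<tau> 0 \<le> M"
    and b_C1: "C1_halfline b b'"
    and b_deriv_0: "b' 0 > d"
    and b_sublinear: "\<forall>u>0. b u < b' 0 * u"
    and b_deriv_bound: "\<forall>u\<in>{0..K}. \<bar>b' u\<bar> \<le> b' 0"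
    and "L > 0"
    and b_quadratic: "\<forall>u\<in>{0<..K}. 0 \<le> b' 0 * u - b u \<and> b' 0 * u - b u < L * u\<^sup>2"
    and c_gt: "c > critical_speed d (b' 0) (\<tau> 0)"
  shows "\<exists>\<phi> \<phi>' \<phi>'' :: real \<Rightarrow> real.
           C2_real \<phi> \<phi>' \<phi>'' \<and>
           (\<forall>\<xi>. \<phi> \<xi> > 0) \<and>
           (\<forall>\<xi>. \<phi>'' \<xi> - c * \<phi>' \<xi> - d * \<phi> \<xi> + b (\<phi> (\<xi> - c * \<tau> (\<phi> \<xi>))) = 0) \<and>
           (\<phi> \<longlongrightarrow> 0) at_bot \<and>
           Liminf at_top (\<lambda>\<xi>. ereal (\<phi> \<xi>)) > 0"
proof -
  define \<beta> where "\<beta> = b' 0"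
  have \<beta>: "\<beta> > d" using b_deriv_0 by (simp add: \<beta>_def)
  note crit = is_critical_speed_critical_speed[OF \<open>d > 0\<close> \<beta> tau_0(1)]
  have c_cs: "c > critical_speed d \<beta> (\<tau> 0)" using c_gt by (simp add: \<beta>_def)
  have c: "c > 0" using crit c_cs unfolding is_critical_speed_def by auto
  obtain l1 l2 where l: "l1 < l2" "{l. 0 < l \<and> char_fun d \<beta> (\<tau> 0) l c = 0} = {l1, l2}"
    "\<forall>l\<in>{l1<..<l2}. char_fun d \<beta> (\<tau> 0) l c < 0"
    using crit c_cs unfolding is_critical_speed_def by blast
  then have l1: "0 < l1" "char_fun d \<beta> (\<tau> 0) l1 c = 0" by auto
  \<comment> \<open>The midpoint between l1 and the smaller of 2 l1 and l2: it lies below 2 l1 and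
    between the roots, where the characteristic function is negative.\<close>
  define nu where "nu = (l1 + min (2 * l1) l2) / 2"
  have nu: "l1 < nu" "nu < 2 * l1" "nu < l2" using l(1) l1(1) by (auto simp: nu_def min_def)
  define \<kappa> where "\<kappa> = - char_fun d \<beta> (\<tau> 0) nu c"
  have \<kappa>: "\<kappa> > 0" using l(3) nu by (simp add: \<kappa>_def)
  \<comment> \<open>Here \<open>exp (l1 * x1) = min K 1\<close>. The first entry of the maximum
    defining q gives \<open>q_large\<close>; the second puts the zero of the lower barrier at or to
    the left of x1.\<close>
  define x1 where "x1 = ln (min K 1) / l1"
  define q where "q = max ((\<beta> * l1 * (1 + c) + L) / \<kappa>) (exp (- (nu - l1) * x1))"
  have q: "q > 0" unfolding q_def by (simp add: less_max_iff_disj)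
  have q_dom: "x \<le> 0 \<and> exp (l1 * x) \<le> K" if "0 < exp (l1 * x) - q * exp (nu * x)" for x
  proof -
    have "exp (- (nu - l1) * x1) * exp (nu * x) \<le> q * exp (nu * x)"
      by (intro mult_right_mono) (auto simp: q_def)
    then have "exp (- (nu - l1) * x1 + nu * x) < exp (l1 * x)"
      unfolding exp_add using that by linarith
    then have "(nu - l1) * x < (nu - l1) * x1" by (simp add: algebra_simps)
    then have "x < x1" using nu by simp
    then have "l1 * x < ln (min K 1)" using l1 by (simp add: x1_def field_simps)
    then have "exp (l1 * x) < min K 1" using \<open>K > 0\<close>
      by (metis exp_less_mono exp_ln min_less_iff_conj zero_less_one min_def)
    then show ?thesis using l1(1) by (auto simp: mult_less_0_iff)
  qed
  have b_der: "(b has_real_derivative b' u) (at u within {0..})" if "u \<ge> 0" for u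
    using b_C1 that by (simp add: C1_halfline_def)
  have tau_der: "(\<tau> has_real_derivative \<tau>' u) (at u within {0..})" if "u \<ge> 0" for u
    using tau_C1 that by (simp add: C1_halfline_def)
  have b_cont: "continuous_on {0..} b"
    unfolding continuous_on_eq_continuous_within using b_der by (auto intro: DERIV_continuous)
  have b_cont': "continuous_on {s..t} b" if "s \<ge> 0" for s t
    using b_cont that by (auto elim: continuous_on_subset)
  have "\<exists>x\<in>{0..K}. \<forall>u\<in>{0..K}. b u \<le> b x"
    using \<open>K > 0\<close> by (intro continuous_attains_sup b_cont') auto
  then obtain B where B: "\<And>u. u \<in> {0..K} \<Longrightarrow> b u \<le> B" by blast
  \<comment> \<open>On [0, K] the values of b are at most \<open>B \<le> d * U\<close>; above K,
    \<open>b u < d * u \<le> d * U\<close>.\<close>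
  define U where "U = max K (B / d)"
  have U: "K \<le> U" "B \<le> d * U" using \<open>d > 0\<close> by (auto simp: U_def max_def field_simps)
  have U0: "U > 0" using U \<open>K > 0\<close> by simp
  \<comment> \<open>Without monotonicity, the positive minimum of b on [K, U] supplies the
    persistence threshold for \<open>v \<ge> K\<close>; for \<open>v < K\<close> the inequality
    \<open>b v > d * v\<close> suffices.\<close>
  obtain u0 where u0: "u0 \<in> {K..U}" "\<And>u. u \<in> {K..U} \<Longrightarrow> b u0 \<le> b u"
    using continuous_attains_inf[OF _ _ b_cont', of K U] U \<open>K > 0\<close> by auto
  have "b u0 > 0"
    using u0(1) b_above_K b_K \<open>d > 0\<close> \<open>K > 0\<close> by (cases "u0 = K") auto
  interpret wave c d U K L \<beta> l1 nu q b \<tau>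
  proof
    show "0 \<le> u \<Longrightarrow> u \<le> U \<Longrightarrow> b u \<le> d * U" for u
    proof (cases "u \<le> K")
      case False
      assume "0 \<le> u" "u \<le> U"
      then have "d * u \<le> d * U" using \<open>d > 0\<close> by simp
      then show ?thesis using False b_above_K by (smt (verit))
    qed (use B[of u] U in auto)
    show "0 \<le> u \<Longrightarrow> b u \<le> \<beta> * u" for u
      using b_sublinear b_zero by (cases "u = 0") (auto simp: \<beta>_def less_imp_le)
    show "0 \<le> u \<Longrightarrow> u \<le> K \<Longrightarrow> \<beta> * u - L * u\<^sup>2 \<le> b u" for u
      using bspec[OF b_quadratic, of u] b_zero by (cases "u = 0") (auto simp: \<beta>_def)
    show "\<bar>\<tau> u - \<tau> v\<bar> \<le> \<bar>u - v\<bar>" if "0 \<le> u" "0 \<le> v" for u v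
    proof -
      have "norm (\<tau> u - \<tau> v) \<le> 1 * norm (u - v)"
        by (rule field_differentiable_bound[of "{0..}" \<tau> \<tau>'])
          (use tau_der tau_deriv that in \<open>auto simp: less_imp_le\<close>)
      then show ?thesis by simp
    qed
    show "\<tau> 0 \<le> \<tau> u" if "0 \<le> u" for u
    proof (cases "u = 0")
      case False
      have "(\<tau> has_derivative (*) (\<tau>' x)) (at x within {0..u})" if "0 \<le> x" for x
        using tau_der[OF that] unfolding has_field_derivative_def
        by (rule has_derivative_subset) auto
      then have "\<exists>x\<in>{0<..<u}. \<tau> u - \<tau> 0 = \<tau>' x * (u - 0)"
        using that False by (intro mvt_simple[where f' = "\<lambda>x. (*) (\<tau>' x)"]) auto
      then obtain x where "0 < x" "\<tau> u - \<tau> 0 = \<tau>' x * u" by auto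
      then show ?thesis using tau_deriv that by (smt (verit) mult_nonneg_nonneg)
    qed simp
    show "\<beta> * l1 * (1 + c) + L \<le> q * - char_fun d \<beta> (\<tau> 0) nu c"
    proof -
      have "(\<beta> * l1 * (1 + c) + L) / \<kappa> \<le> q" by (simp add: q_def)
      then show ?thesis using \<kappa> unfolding \<kappa>_def[symmetric] by (simp add: field_simps)
    qed
  qed (use assms U b_cont' \<beta> c l1 nu q q_dom in auto)
  have "d * u < b v" if u: "0 < u" "u < min K (b u0 / d)" "u \<le> v" "v \<le> U" for u v
  proof (cases "v < K")
    case True
    have "d * u \<le> d * v" using u \<open>d > 0\<close> by simp
    then show ?thesis using b_below_K True u by (smt (verit))
  next
    case False
    have "d * u < b u0" using u(2) \<open>d > 0\<close> by (simp add: field_simps)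
    then show ?thesis using u0(2)[of v] False u by simp
  qed
  moreover have "0 < min K (b u0 / d)" using \<open>K > 0\<close> \<open>d > 0\<close> \<open>b u0 > 0\<close> by simp
  ultimately show ?thesis by (metis travelling_wave)
qed

end
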